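(* Let $X$ be a connected graph on $n$ vertices, and suppose $X\notin\{K_n,S_n\}$ (up to isomorphism). Then $\operatorname{tr}(X)\le \operatorname{tr}(K_{n-2,1,1})$, with equality if and only if $X=K_{n-2,1,1}$ (up to isomorphism).
   Context: Graphs are finite and simple. For a graph $X$, let $L=D-A$ be its Laplacian matrix, with spectral decomposition $L=\sum_\lambda \lambda E_\lambda$, where $\lambda$ runs over the distinct eigenvalues of $L$ and $E_\lambda$ is the orthogonal projection onto the $\lambda$-eigenspace. The average mixing matrix is $\widehat{M}=\sum_\lambda E_\lambda\circ E_\lambda$ ($\circ$ is the entrywise product), and the laziness of $X$ is $\operatorname{tr}(X):=\operatorname{tr}(\widehat M)=\sum_\lambda\sum_{u\in V(X)} ((E_\lambda)_{uu})^2$. $K_n$ is the complete graph, $S_n$ is the star on $n$ vertices, and $K_{n-2,1,1}$ is the complete multipartite graph with parts of sizes $n-2,1,1$. *)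

theory Defs
  imports "HOL-Analysis.Analysis" "Graph_Theory.Graph_Theory"
begin

section \<open>Graphs\<close>

text \<open>
  A finite simple graph is a loop-free symmetric digraph without multiple arcs, each edge
  giving two opposite arcs; these are the locales \<^locale>\<open>graph\<close> and, with arcs
  that are pairs of vertices, \<^locale>\<open>pair_graph\<close>. The matrices below are indexed by the
  vertex type, so they are meant for graphs whose vertex set is the whole type.
\<close>

definition complete_multipartite_digraph :: "nat list \<Rightarrow> ('a,'b) pre_digraph \<Rightarrow> bool" where
  "complete_multipartite_digraph ns G \<longleftrightarrow> graph G \<and>
     (\<exists>part. (\<forall>v\<in>verts G. part v < length ns) \<and>
        (\<forall>i<length ns. card {v \<in> verts G. part v = i} = ns ! i) \<and>
        arcs_ends G = {(u,v). u \<in> verts G \<and> v \<in> verts G \<and> part u \<noteq> part v})"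

definition star_digraph :: "nat \<Rightarrow> ('a,'b) pre_digraph \<Rightarrow> bool" where
  "star_digraph n G \<longleftrightarrow> n \<ge> 1 \<and> complete_bipartite_digraph 1 (n - 1) G"


section \<open>Spectral idempotents\<close>

definition eigenspace :: "real^'n^'n \<Rightarrow> real \<Rightarrow> (real^'n) set" where
  "eigenspace M l = {x. M *v x = l *\<^sub>R x}"

definition eigenvalues :: "real^'n^'n \<Rightarrow> real set" where
  "eigenvalues M = {l. \<exists>x. x \<noteq> 0 \<and> M *v x = l *\<^sub>R x}"

definition is_orth_proj :: "(real^'n) set \<Rightarrow> real^'n^'n \<Rightarrow> bool" where
  "is_orth_proj S P \<longleftrightarrow> (\<forall>x. P *v x \<in> S \<and> (\<forall>y\<in>S. orthogonal (x - P *v x) y))"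

definition orth_proj :: "(real^'n) set \<Rightarrow> real^'n^'n" where
  "orth_proj S = (THE P. is_orth_proj S P)"

definition hadamard :: "real^'n^'m \<Rightarrow> real^'n^'m \<Rightarrow> real^'n^'m" where
  "hadamard A B = (\<chi> i j. A $ i $ j * B $ i $ j)"


section \<open>Laplacian, average mixing matrix and laziness\<close>

definition adjacency_matrix :: "('a::finite,'b) pre_digraph \<Rightarrow> real^'a^'a" where
  "adjacency_matrix G = (\<chi> u v. if (u,v) \<in> arcs_ends G then 1 else 0)"

definition degree_matrix :: "('a::finite,'b) pre_digraph \<Rightarrow> real^'a^'a" where
  "degree_matrix G = (\<chi> u v. if u = v then real (out_degree G u) else 0)"

definition laplacian :: "('a::finite,'b) pre_digraph \<Rightarrow> real^'a^'a" where
  "laplacian G = degree_matrix G - adjacency_matrix G"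

definition avg_mixing_matrix :: "('a::finite,'b) pre_digraph \<Rightarrow> real^'a^'a" where
  "avg_mixing_matrix G =
     (\<Sum>l\<in>eigenvalues (laplacian G).
        hadamard (orth_proj (eigenspace (laplacian G) l)) (orth_proj (eigenspace (laplacian G) l)))"

definition laziness :: "('a::finite,'b) pre_digraph \<Rightarrow> real" where
  "laziness G = trace (avg_mixing_matrix G)"


section \<open>The notions are well defined\<close>

lemma is_orth_proj_unique:
  assumes S: "subspace S" and P: "is_orth_proj S P" and Q: "is_orth_proj S Q"
  shows "P = Q"
proof -
  have "P *v x = Q *v x" for x
  proof -
    let ?d = "P *v x - Q *v x"
    have d: "?d \<in> S"
      using S P Q by (simp add: is_orth_proj_def subspace_diff)
    have "(x - P *v x) \<bullet> ?d = 0" "(x - Q *v x) \<bullet> ?d = 0"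
      using d P Q by (auto simp: is_orth_proj_def orthogonal_def)
    then have "?d \<bullet> ?d = 0"
      by (simp add: inner_diff_left)
    then show ?thesis by simp
  qed
  then show ?thesis by (simp add: matrix_eq)
qed

lemma is_orth_proj_orth_proj:
  fixes S :: "(real^'n) set"
  assumes S: "subspace S"
  shows "is_orth_proj S (orth_proj S)"
proof -
  obtain B where B: "B \<subseteq> S" "pairwise orthogonal B" "\<And>x. x \<in> B \<Longrightarrow> norm x = 1"
    "independent B" "span B = S"
    using orthonormal_basis_subspace[OF S] by metis
  have fin: "finite B"
    using B(4) independent_imp_finite by blast
  define f where "f = (\<lambda>x::real^'n. \<Sum>b\<in>B. (x \<bullet> b) *\<^sub>R b)"
  have lin: "linear f"
    unfolding f_def
    by (intro linearI) (auto simp: inner_add_left scaleR_add_left sum.distrib scaleR_sum_right)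
  have f: "matrix f *v x = f x" for x
    using matrix_works[of f x] lin by (simp add: linear_def scalar_mult_eq_scaleR[abs_def])
  have "f x \<in> S" for x
    unfolding f_def using B(1) S by (intro subspace_sum subspace_scale) auto
  moreover have "orthogonal (x - f x) y" if "y \<in> S" for x y
  proof -
    have "orthogonal (x - f x) c" if c: "c \<in> B" for c
    proof -
      have "f x \<bullet> c = (\<Sum>b\<in>B. (x \<bullet> b) * (b \<bullet> c))"
        by (simp add: f_def inner_sum_left)
      also have "\<dots> = (\<Sum>b\<in>B. if b = c then x \<bullet> c else 0)"
        using B(2) B(3) c
        by (intro sum.cong) (auto simp: pairwise_def orthogonal_def norm_eq_1)
      also have "\<dots> = x \<bullet> c"
        using fin c by simp
      finally show ?thesis
        by (simp add: orthogonal_def inner_diff_left)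
    qed
    then show ?thesis
      using that B(5) orthogonal_to_span by blast
  qed
  ultimately have "is_orth_proj S (matrix f)"
    unfolding is_orth_proj_def f by blast
  then show ?thesis
    unfolding orth_proj_def using is_orth_proj_unique[OF S] by (metis theI)
qed

lemma subspace_eigenspace: "subspace (eigenspace M l)"
  by (auto simp: eigenspace_def intro!: subspaceI
      simp: matrix_vector_right_distrib scaleR_add_right matrix_vector_mult_scaleR scaleR_left_commute)

lemma finite_eigenvalues:
  fixes M :: "real^'n^'n"
  assumes M: "transpose M = M"
  shows "finite (eigenvalues M)"
proof -
  define f where "f l = (SOME x. x \<noteq> 0 \<and> M *v x = l *\<^sub>R x)" for l
  have f: "f l \<noteq> 0" "M *v f l = l *\<^sub>R f l" if "l \<in> eigenvalues M" for l
    using that someI_ex[of "\<lambda>x. x \<noteq> 0 \<and> M *v x = l *\<^sub>R x"]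
    by (auto simp: eigenvalues_def f_def)
  have orth: "orthogonal (f k) (f l)" if "k \<in> eigenvalues M" "l \<in> eigenvalues M" "k \<noteq> l" for k l
  proof -
    have "k * (f k \<bullet> f l) = (M *v f k) \<bullet> f l"
      using f(2)[OF that(1)] by simp
    also have "\<dots> = f k \<bullet> (M *v f l)"
      using dot_lmul_matrix[of "f k" M "f l"] M
      by (metis transpose_matrix_vector)
    also have "\<dots> = l * (f k \<bullet> f l)"
      using f(2)[OF that(2)] by simp
    finally show ?thesis using that(3) by (simp add: orthogonal_def)
  qed
  have inj: "inj_on f (eigenvalues M)"
    using orth f(1) by (metis inj_onI orthogonal_self)
  have "pairwise orthogonal (f ` eigenvalues M)"
    using orth by (auto simp: pairwise_def)
  then have "finite (f ` eigenvalues M)"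
    using pairwise_orthogonal_imp_finite by blast
  then show ?thesis using inj finite_imageD by blast
qed

lemma transpose_laplacian:
  assumes "graph G"
  shows "transpose (laplacian G) = laplacian G"
proof -
  interpret graph G by fact
  have "(u,v) \<in> arcs_ends G \<longleftrightarrow> (v,u) \<in> arcs_ends G" for u v
    using sym_arcs by (auto simp: symmetric_def dest: symD)
  then show ?thesis
    by (simp add: laplacian_def degree_matrix_def adjacency_matrix_def transpose_def vec_eq_iff)
qed

lemma laziness_eq:
  "laziness G =
     (\<Sum>l\<in>eigenvalues (laplacian G). \<Sum>u\<in>UNIV. (orth_proj (eigenspace (laplacian G) l) $ u $ u)\<^sup>2)"
  unfolding laziness_def avg_mixing_matrix_def trace_def hadamard_def
  by (simp add: power2_eq_square sum.swap[of _ UNIV])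

lemma ex_complete_multipartite_digraph:
  assumes "CARD('a::finite) \<ge> 2"
  shows "\<exists>G::'a pair_pre_digraph. pverts G = UNIV \<and>
           complete_multipartite_digraph [CARD('a) - 2, 1, 1] (with_proj G)"
proof -
  obtain a b :: 'a where ab: "a \<noteq> b"
    using assms by (metis One_nat_def card_1_singleton_iff card_2_iff' UNIV_I
        card_le_Suc0_iff_eq finite not_less_eq_eq numeral_2_eq_2)
  define p :: "'a \<Rightarrow> nat" where "p v = (if v = a then 1 else if v = b then 2 else 0)" for v
  define G :: "'a pair_pre_digraph" where "G = \<lparr>pverts = UNIV, parcs = {(u,v). p u \<noteq> p v}\<rparr>"
  interpret pair_graph G
    by unfold_locales (auto simp: G_def symmetric_def sym_def)
  have g: "graph (with_proj G)" by unfold_locales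
  have "{v. p v = 0} = UNIV - {a,b}" "{v. p v = 1} = {a}" "{v. p v = 2} = {b}"
    using ab by (auto simp: p_def)
  moreover have "card (UNIV - {a,b}) = CARD('a) - 2"
    using ab by (simp add: card_Diff_subset)
  ultimately have c: "\<forall>i<3. card {v. p v = i} = [CARD('a) - 2, 1, 1] ! i"
    by (auto simp: less_Suc_eq numeral_eq_Suc)
  have "complete_multipartite_digraph [CARD('a) - 2, 1, 1] (with_proj G)"
    unfolding complete_multipartite_digraph_def
    using g c by (intro conjI exI[of _ p]) (auto simp: G_def p_def numeral_eq_Suc)
  then show ?thesis
    by (intro exI[of _ G]) (auto simp: G_def)
qed

end

theory Submission
  imports Defs
begin

text \<open>
  Write \<open>n\<close> for the number of vertices, \<open>c = 1 - 1/n\<close>, and \<open>p\<^sub>\<lambda>(u)\<close> for the diagonal entries of the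
  spectral projections. As the projection for \<open>0\<close> is \<open>J/n\<close>, the other \<open>p\<^sub>\<lambda>(u)\<close> add up to \<open>c\<close>, and the
  laziness is \<open>1/n + n c\<^sup>2 - D\<close> with the deficit \<open>D = \<Sum>u. c\<^sup>2 - (\<Sum>\<lambda>\<noteq>0. p\<^sub>\<lambda>(u)\<^sup>2)\<close>, which has to be
  bounded below by its value \<open>4 (n - 3) / (n (n - 2))\<close> for the extremal graph.

  Group the nonzero eigenvalues into two classes with projections \<open>P\<close> and \<open>Q\<close> of ranks \<open>m \<ge> k\<close>. Then
  \<open>D \<ge> 2 S\<close> for \<open>S = \<Sum>u. P\<^sub>u\<^sub>u Q\<^sub>u\<^sub>u\<close>, and \<open>(m + 1) S \<ge> m k / n\<close>. For the latter let \<open>p\<close>, \<open>q\<close> be the diagonals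
  of \<open>P\<close>, \<open>Q\<close>. Since \<open>p + q\<close> is constant, \<open>\<bar>Q p\<bar>\<^sup>2 + \<bar>P q\<bar>\<^sup>2 = m k / n - S\<close>. Moreover
  \<open>\<bar>Q p\<bar>\<^sup>2 = m S - m V\<close>, where \<open>m V\<close> measures how far the rows of \<open>Q\<close> are from their \<open>p\<close>-weighted mean,
  and \<open>\<bar>P q\<bar>\<^sup>2 \<le> k V\<close>. If \<open>k \<ge> 2\<close>, this is at least the required bound, and in the case of equality
  \<open>k = 2\<close>, the rows of \<open>Q\<close> agree on all but two vertices, each class is a single eigenvalue, and the
  two exceptional vertices are adjacent to all others.

  Such a grouping fails to exist only if all nonzero eigenvalues are simple and \<open>n = 4\<close>, or if there
  are two nonzero eigenvalues, one of them simple, with unit eigenvector \<open>x\<close>. In the second case the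
  products \<open>x\<^sub>u x\<^sub>v\<close> take only two values, which leaves very few vectors \<open>x\<close>. In the first case the
  inequality for \<open>k = 1\<close> suffices.
\<close>

section \<open>Projections splitting a regular simplex\<close>


definition sym_idem :: "real^'n^'n \<Rightarrow> bool" where
  "sym_idem P \<longleftrightarrow> transpose P = P \<and> P ** P = P"

lemma symmetric_entry:
  assumes "transpose M = M" shows "M $ u $ v = M $ v $ u"
proof -
  have "transpose M $ u $ v = M $ v $ u" by (simp add: transpose_def)
  then show ?thesis by (simp add: assms)
qed

lemma symmetric_inner:
  fixes M :: "real^'n^'n"
  assumes "transpose M = M" shows "(M *v x) \<bullet> y = x \<bullet> (M *v y)"
  using dot_lmul_matrix[of x M y] transpose_matrix_vector[of M x] assms by simp

lemma matrix_mult_symmetric_entry: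
  assumes "transpose Q = (Q::real^'n^'n)"
  shows "(P ** Q) $ u $ v = P $ u \<bullet> Q $ v"
  using symmetric_entry[OF assms] by (simp add: matrix_matrix_mult_def inner_vec_def)

lemma sym_idem_commute: "sym_idem P \<Longrightarrow> P $ u $ v = P $ v $ u"
  unfolding sym_idem_def by (blast intro: symmetric_entry)

lemma sym_idem_inner: "sym_idem P \<Longrightarrow> P $ u \<bullet> P $ v = P $ u $ v"
  by (metis matrix_mult_symmetric_entry sym_idem_def)

lemma sym_idem_diag: "sym_idem P \<Longrightarrow> P $ u $ u = (norm (P $ u))\<^sup>2"
  by (metis power2_norm_eq_inner sym_idem_inner)

lemma sym_idem_diag_nonneg: "sym_idem P \<Longrightarrow> 0 \<le> P $ u $ u"
  by (simp add: sym_idem_diag)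

lemma sym_idem_diag_zero_iff: "sym_idem P \<Longrightarrow> P $ u $ u = 0 \<longleftrightarrow> P $ u = 0"
  by (simp add: sym_idem_diag)

text \<open>By symmetry the rows are also the columns. Images under \<open>P\<close> can thus be
  written with the vectors \<open>P $ u\<close>, whose inner products \<open>sym_idem_inner\<close>
  computes.\<close>

lemma sym_idem_mult_vec: "sym_idem P \<Longrightarrow> P *v x = (\<Sum>u\<in>UNIV. x $ u *\<^sub>R P $ u)"
  by (simp add: vec_eq_iff matrix_vector_mult_def sum_component sym_idem_commute[of P] mult.commute)

lemma trace_sym_idem_square:
  assumes "sym_idem P" shows "(\<Sum>u\<in>UNIV. \<Sum>v\<in>UNIV. (P $ u $ v)\<^sup>2) = trace P"
proof -
  have "(\<Sum>v\<in>UNIV. (P $ u $ v)\<^sup>2) = P $ u $ u" for u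
    using sym_idem_inner[OF assms, of u u] by (simp add: inner_vec_def power2_eq_square)
  then show ?thesis by (simp add: trace_def)
qed

section \<open>Two projections that add up to I - J/n, the projection onto the complement of the
  all-ones vector\<close>

locale simplex_splitting =
  fixes P Q :: "real^'n^'n"
  assumes P: "sym_idem P" and Q: "sym_idem Q" and PQ: "P ** Q = 0"
    and splits: "P $ u $ v + Q $ u $ v = (if u = v then 1 else 0) - 1 / real CARD('n)"
begin

definition cost :: real where "cost = (\<Sum>u\<in>UNIV. P $ u $ u * Q $ u $ u)"

lemma swapped: "simplex_splitting Q P"
proof
  have "Q ** P = transpose (P ** Q)"
    using P Q by (simp add: matrix_transpose_mul sym_idem_def)
  then show "Q ** P = 0"
    by (simp add: PQ transpose_def vec_eq_iff)
qed (use P Q splits in \<open>auto simp: add.commute\<close>)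

lemma cost_swapped: "simplex_splitting.cost Q P = cost"
  unfolding simplex_splitting.cost_def[OF swapped] cost_def by (simp add: mult.commute)

lemma inner_PQ: "P $ u \<bullet> Q $ v = 0"
  using matrix_mult_symmetric_entry[of Q P u v] Q PQ by (simp add: sym_idem_def)

lemma diag_add: "P $ u $ u + Q $ u $ u = 1 - 1 / real CARD('n)"
  using splits[of u u] by simp

lemma trace_add: "trace P + trace Q = real CARD('n) - 1"
  unfolding trace_def sum.distrib[symmetric] diag_add by (simp add: algebra_simps)

lemma mult_vec_add: "P *v x + Q *v x = x - (\<chi> u. (\<Sum>v\<in>UNIV. x $ v) / real CARD('n))"
proof -
  have "(\<Sum>v\<in>UNIV. P $ u $ v * x $ v) + (\<Sum>v\<in>UNIV. Q $ u $ v * x $ v)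
      = x $ u - (\<Sum>v\<in>UNIV. x $ v) / real CARD('n)" for u
  proof -
    have "(\<Sum>v\<in>UNIV. P $ u $ v * x $ v) + (\<Sum>v\<in>UNIV. Q $ u $ v * x $ v)
      = (\<Sum>v\<in>UNIV. (if u = v then x $ v else 0) - x $ v / real CARD('n))"
      unfolding sum.distrib[symmetric] distrib_right[symmetric] splits
      by (intro sum.cong) (auto simp: algebra_simps)
    also have "\<dots> = x $ u - (\<Sum>v\<in>UNIV. x $ v) / real CARD('n)"
      by (simp add: sum_subtractf sum_divide_distrib)
    finally show ?thesis .
  qed
  then show ?thesis by (simp add: vec_eq_iff matrix_vector_mult_def)
qed

text \<open>The projections add up to I - J/n, which kills the all-ones vector. Applying
  \<open>P\<close> to \<open>P *v 1 + Q *v 1 = 0\<close> removes the \<open>Q\<close> part and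
  leaves \<open>P *v 1\<close>.\<close>

lemma P_one: "P *v 1 = 0"
proof -
  have "P *v 1 + Q *v 1 = 0"
    by (simp add: mult_vec_add) (simp add: vec_eq_iff)
  then have "P *v (P *v 1) + P *v (Q *v 1) = 0"
    by (metis matrix_vector_mult_0_right matrix_vector_right_distrib)
  then show ?thesis using P PQ by (simp add: matrix_vector_mul_assoc sym_idem_def)
qed

lemma sum_row: "(\<Sum>v\<in>UNIV. P $ u $ v) = 0"
  using P_one by (simp add: vec_eq_iff matrix_vector_mult_def)

text \<open>
  With the rows \<open>g u\<close> of \<open>Q\<close> and \<open>h u\<close> of \<open>P\<close>, the vectors \<open>(h u, g u)\<close> are the vertices of
  a regular simplex, whence the name of the locale. \<open>gbar\<close> and \<open>spread\<close> are a mean and a variance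
  of \<open>g\<close> for the weights \<open>P $ u $ u\<close>.
\<close>

definition gbar :: "real^'n" where
  "gbar = (1 / trace P) *\<^sub>R (\<Sum>u\<in>UNIV. P $ u $ u *\<^sub>R Q $ u)"

definition spread :: real where
  "spread = (\<Sum>u\<in>UNIV. P $ u $ u * (norm (Q $ u - gbar))\<^sup>2)"

text \<open>This is \<open>P\<close> applied to the diagonal of \<open>Q\<close>, and
  \<open>qp\<close> is \<open>Q\<close> applied to the diagonal of \<open>P\<close>. These are the
  vectors P q and Q p of the introduction.\<close>

definition pq :: "real^'n" where
  "pq = (\<Sum>u\<in>UNIV. Q $ u $ u *\<^sub>R P $ u)"

definition qp :: "real^'n" where
  "qp = (\<Sum>u\<in>UNIV. P $ u $ u *\<^sub>R Q $ u)"

lemma qp_swapped: "simplex_splitting.pq Q P = qp"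
  unfolding simplex_splitting.pq_def[OF swapped] qp_def by simp

lemma spread_nonneg: "0 \<le> spread"
  unfolding spread_def using P by (intro sum_nonneg mult_nonneg_nonneg sym_idem_diag_nonneg) auto

text \<open>The diagonal of \<open>Q\<close> is a constant minus that of \<open>P\<close>, and
  \<open>P\<close> kills constants, so \<open>pq\<close> is minus \<open>P\<close> applied to its
  own diagonal. Hence \<open>qp - pq\<close> is the diagonal of \<open>P\<close> minus its mean. As
  \<open>qp\<close> and \<open>pq\<close> are orthogonal, Pythagoras turns the left side into the
  unnormalized variance of that diagonal.\<close>

lemma norm_qp_pq: "(norm qp)\<^sup>2 + (norm pq)\<^sup>2 = trace P * trace Q / real CARD('n) - cost"
proof -
  let ?n = "real CARD('n)" and ?p = "(\<chi> u. P $ u $ u) :: real^'n"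
  let ?q = "(\<chi> u. Q $ u $ u) :: real^'n"
  have qp: "qp = Q *v ?p" and pq: "pq = P *v ?q"
    by (simp_all add: qp_def pq_def sym_idem_mult_vec P Q)
  have "?q = (1 - 1 / ?n) *\<^sub>R 1 - ?p"
    using diag_add by (auto simp: vec_eq_iff algebra_simps)
  then have "pq = - (P *v ?p)"
    unfolding pq by (simp add: matrix_vector_mult_diff_distrib matrix_vector_mult_scaleR P_one)
  then have diff: "qp - pq = ?p - (\<chi> u. trace P / ?n)"
    using mult_vec_add[of ?p] by (simp add: qp trace_def algebra_simps)
  have "qp \<bullet> pq = 0"
    by (simp add: qp_def pq_def inner_sum_left inner_sum_right inner_PQ inner_commute[of "Q $ _"])
  then have "(norm qp)\<^sup>2 + (norm pq)\<^sup>2 = (norm (qp - pq))\<^sup>2"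
    by (simp add: power2_norm_eq_inner inner_diff_left inner_diff_right inner_commute)
  also have "\<dots> = (\<Sum>u\<in>UNIV. (P $ u $ u - trace P / ?n)\<^sup>2)"
    unfolding diff power2_norm_eq_inner inner_vec_def by (simp add: power2_eq_square)
  \<comment> \<open>With p and q the two diagonal entries at u, p + q = 1 - 1/n gives p^2 = (1 -
    1/n) p - p q. The square thus becomes linear in p up to the summand of
    \<open>cost\<close>.\<close>
  also have "\<dots> = (\<Sum>u\<in>UNIV. (1 - 1 / ?n - 2 * trace P / ?n) * P $ u $ u
      - P $ u $ u * Q $ u $ u + (trace P / ?n)\<^sup>2)"
  proof (intro sum.cong refl)
    fix u
    have q: "Q $ u $ u = 1 - 1 / ?n - P $ u $ u" using diag_add[of u] by simp
    show "(P $ u $ u - trace P / ?n)\<^sup>2 = (1 - 1 / ?n - 2 * trace P / ?n) * P $ u $ u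
      - P $ u $ u * Q $ u $ u + (trace P / ?n)\<^sup>2"
      unfolding q by (simp add: power2_eq_square field_simps)
  qed
  also have "\<dots> = (1 - 1 / ?n - 2 * trace P / ?n) * trace P - cost + ?n * (trace P / ?n)\<^sup>2"
    by (simp add: sum.distrib sum_subtractf trace_def cost_def sum_distrib_left[symmetric])
  also have "\<dots> = trace P * (?n - 1 - trace P) / ?n - cost"
    by (simp add: field_simps power2_eq_square)
  also have "?n - 1 - trace P = trace Q" using trace_add by simp
  finally show ?thesis .
qed

text \<open>A weighted variance is the second moment minus the squared mean. Since the squared norm
  of \<open>Q $ u\<close> is \<open>Q $ u $ u\<close>, the second moment is \<open>cost\<close>; the
  mean is \<open>gbar\<close>, and \<open>qp\<close> is \<open>trace P\<close> times it.\<close>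

lemma norm_qp_spread:
  assumes "trace P > 0" shows "(norm qp)\<^sup>2 + trace P * spread = trace P * cost"
proof -
  have g: "trace P *\<^sub>R gbar = qp" using assms by (simp add: gbar_def qp_def)
  have qp2: "(norm qp)\<^sup>2 = (trace P)\<^sup>2 * (norm gbar)\<^sup>2"
    by (simp add: g[symmetric] power_mult_distrib)
  have "spread = (\<Sum>u\<in>UNIV. P $ u $ u * Q $ u $ u - 2 * ((P $ u $ u *\<^sub>R Q $ u) \<bullet> gbar)
      + P $ u $ u * (norm gbar)\<^sup>2)"
    unfolding spread_def
    by (intro sum.cong refl)
      (simp add: power2_norm_eq_inner inner_diff_left inner_diff_right sym_idem_inner Q
        inner_commute[of gbar "Q $ _"] algebra_simps)
  also have "\<dots> = cost - 2 * (qp \<bullet> gbar) + trace P * (norm gbar)\<^sup>2"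
    by (simp add: sum.distrib sum_subtractf cost_def qp_def inner_sum_left
        sum_distrib_left[symmetric] sum_distrib_right[symmetric] trace_def)
  also have "qp \<bullet> gbar = trace P * (norm gbar)\<^sup>2"
    by (simp add: g[symmetric] power2_norm_eq_inner)
  finally have "spread = cost - trace P * (norm gbar)\<^sup>2" by simp
  then show ?thesis by (simp add: qp2 power2_eq_square[of "trace P"] right_diff_distrib)
qed

text \<open>The sum is \<open>Q *v pq\<close>, and \<open>pq\<close> lies in the range of
  \<open>P\<close>, which \<open>Q\<close> annihilates.\<close>

lemma pq_orth: "(\<Sum>u\<in>UNIV. pq $ u *\<^sub>R Q $ u) = 0"
proof -
  have "(\<Sum>u\<in>UNIV. pq $ u *\<^sub>R Q $ u) = Q *v pq" by (simp add: sym_idem_mult_vec Q)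
  also have "\<dots> = (\<Sum>u\<in>UNIV. Q $ u $ u *\<^sub>R (Q *v P $ u))"
    by (simp add: pq_def linear_sum[OF matrix_vector_mul_linear]
        matrix_vector_mult_scaleR)
  also have "\<dots> = 0"
    by (intro sum.neutral) (simp add: vec_eq_iff matrix_vector_mult_def inner_PQ[unfolded inner_vec_def, simplified] mult.commute)
  finally show ?thesis .
qed

text \<open>
  By \<open>pq_orth\<close> only one of the two factors \<open>Q $ u\<close> has to be shifted by \<open>gbar\<close>. This makes the
  bound on \<open>norm pq\<close> sharp: Cauchy-Schwarz then gives the factor \<open>trace Q\<close>, whereas shifting both
  factors would enlarge it.
\<close>

lemma norm_pq_pair:
  "(norm pq)\<^sup>2 = (\<Sum>u\<in>UNIV. pq $ u * ((Q $ u - gbar) \<bullet> Q $ u))"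
proof -
  let ?q = "(\<chi> u. Q $ u $ u) :: real^'n"
  have pq: "pq = P *v ?q" by (simp add: pq_def sym_idem_mult_vec P)
  then have "P *v pq = pq"
    using P by (simp add: matrix_vector_mul_assoc sym_idem_def)
  moreover have "?q \<bullet> (P *v pq) = (P *v ?q) \<bullet> pq"
    using symmetric_inner[of P ?q pq] P by (simp add: sym_idem_def)
  ultimately have "(norm pq)\<^sup>2 = ?q \<bullet> pq" by (simp add: pq[symmetric] power2_norm_eq_inner)
  also have "\<dots> = (\<Sum>u\<in>UNIV. pq $ u * Q $ u $ u)"
    by (simp add: inner_vec_def mult.commute)
  also have "\<dots> = (\<Sum>u\<in>UNIV. pq $ u * Q $ u $ u) - gbar \<bullet> (\<Sum>u\<in>UNIV. pq $ u *\<^sub>R Q $ u)"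
    by (simp add: pq_orth)
  also have "\<dots> = (\<Sum>u\<in>UNIV. pq $ u * ((Q $ u - gbar) \<bullet> Q $ u))"
    by (simp add: inner_sum_right sum_subtractf[symmetric] inner_diff_left sym_idem_inner Q
        algebra_simps)
  finally show ?thesis .
qed

text \<open>The coordinate is the inner product of \<open>pq\<close> with \<open>P $ u\<close>, a
  vector of squared norm \<open>P $ u $ u\<close>, so Cauchy-Schwarz applies.\<close>

lemma pq_comp_le: "(pq $ u)\<^sup>2 \<le> (norm pq)\<^sup>2 * P $ u $ u"
proof -
  have "pq $ u = P $ u \<bullet> pq"
    by (simp add: pq_def inner_sum_right sym_idem_inner P sum_component sym_idem_commute[of P u])
  then have "\<bar>pq $ u\<bar> \<le> norm (P $ u) * norm pq"
    by (simp add: Cauchy_Schwarz_ineq2)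
  then have "(pq $ u)\<^sup>2 \<le> (norm (P $ u) * norm pq)\<^sup>2"
    by (meson abs_ge_zero abs_le_square_iff abs_of_nonneg order_trans norm_ge_zero mult_nonneg_nonneg power2_le_iff_abs_le)
  then show ?thesis by (simp add: sym_idem_diag P power_mult_distrib mult.commute)
qed

text \<open>The left side measures the failure of equality in Cauchy-Schwarz for the pairing in
  \<open>norm_pq_pair\<close>; expanding the squares evaluates it. The exact identity serves both
  the inequality and its equality case.\<close>

lemma norm_pq_defect:
  "(\<Sum>u\<in>UNIV. (norm (trace Q *\<^sub>R pq $ u *\<^sub>R (Q $ u - gbar) - (norm pq)\<^sup>2 *\<^sub>R Q $ u))\<^sup>2)
    = (trace Q)\<^sup>2 * (\<Sum>u\<in>UNIV. (pq $ u)\<^sup>2 * (norm (Q $ u - gbar))\<^sup>2) - trace Q * (norm pq)^4"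
proof -
  let ?Y = "(norm pq)\<^sup>2" and ?k = "trace Q"
  have "(norm (?k *\<^sub>R pq $ u *\<^sub>R (Q $ u - gbar) - ?Y *\<^sub>R Q $ u))\<^sup>2
    = ?k\<^sup>2 * ((pq $ u)\<^sup>2 * (norm (Q $ u - gbar))\<^sup>2)
      - 2 * ?k * ?Y * (pq $ u * ((Q $ u - gbar) \<bullet> Q $ u)) + ?Y\<^sup>2 * Q $ u $ u" for u
  proof -
    have "(norm (a *\<^sub>R x - b *\<^sub>R y))\<^sup>2 = a\<^sup>2 * (norm x)\<^sup>2 - 2 * a * b * (x \<bullet> y) + b\<^sup>2 * (norm y)\<^sup>2"
      for a b and x y :: "real^'n"
      unfolding power2_norm_eq_inner
      by (simp add: inner_diff_left inner_diff_right inner_commute[of y x]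
          power2_eq_square algebra_simps)
    from this[of "?k * pq $ u" "Q $ u - gbar" ?Y "Q $ u"] show ?thesis
      by (simp add: sym_idem_diag[OF Q] power_mult_distrib algebra_simps)
  qed
  then have "(\<Sum>u\<in>UNIV. (norm (?k *\<^sub>R pq $ u *\<^sub>R (Q $ u - gbar) - ?Y *\<^sub>R Q $ u))\<^sup>2)
    = ?k\<^sup>2 * (\<Sum>u\<in>UNIV. (pq $ u)\<^sup>2 * (norm (Q $ u - gbar))\<^sup>2) - 2 * ?k * ?Y * ?Y + ?Y\<^sup>2 * ?k"
    by (simp add: sum.distrib sum_subtractf sum_distrib_left[symmetric] norm_pq_pair[symmetric]
        trace_def)
  then show ?thesis by (simp add: power2_eq_square power4_eq_xxxx algebra_simps)
qed

lemma sum_pq_comp_le: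
  "(\<Sum>u\<in>UNIV. (pq $ u)\<^sup>2 * (norm (Q $ u - gbar))\<^sup>2) \<le> (norm pq)\<^sup>2 * spread"
  unfolding spread_def sum_distrib_left mult.assoc[symmetric]
  by (intro sum_mono mult_right_mono pq_comp_le) auto

lemma norm_pq_le:
  assumes k: "trace Q > 0" shows "(norm pq)\<^sup>2 \<le> trace Q * spread"
proof (cases "pq = 0")
  case True
  then show ?thesis using k spread_nonneg by simp
next
  case False
  have "0 \<le> (trace Q)\<^sup>2 * (\<Sum>u\<in>UNIV. (pq $ u)\<^sup>2 * (norm (Q $ u - gbar))\<^sup>2) - trace Q * (norm pq)^4"
    unfolding norm_pq_defect[symmetric] by (intro sum_nonneg) auto
  also have "\<dots> \<le> (trace Q)\<^sup>2 * ((norm pq)\<^sup>2 * spread) - trace Q * (norm pq)^4"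
    by (intro diff_right_mono mult_left_mono sum_pq_comp_le) auto
  also have "\<dots> = (trace Q * (norm pq)\<^sup>2) * (trace Q * spread - (norm pq)\<^sup>2)"
    by (simp add: power2_eq_square power4_eq_xxxx algebra_simps)
  finally have "0 \<le> (trace Q * (norm pq)\<^sup>2) * (trace Q * spread - (norm pq)\<^sup>2)" .
  moreover have "trace Q * (norm pq)\<^sup>2 > 0" using k False by simp
  ultimately show ?thesis by (simp only: zero_le_mult_iff) linarith
qed

text \<open>With m and k the traces of \<open>P\<close> and \<open>Q\<close>,
  \<open>norm_pq_le\<close> and k <= m bound the squared norm of \<open>pq\<close> by m times
  \<open>spread\<close>. Adding \<open>norm_qp_spread\<close> cancels \<open>spread\<close>, so the
  left side of \<open>norm_qp_pq\<close> is at most m times \<open>cost\<close>.\<close>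

lemma cost_bound:
  assumes "trace Q > 0" "trace Q \<le> trace P"
  shows "trace P * trace Q / real CARD('n) \<le> (trace P + 1) * cost"
proof -
  have "(norm pq)\<^sup>2 \<le> trace P * spread"
    using norm_pq_le assms spread_nonneg by (meson mult_right_mono order_trans)
  then show ?thesis
    using norm_qp_pq norm_qp_spread assms by (simp add: algebra_simps)
qed

text \<open>Equality makes the squared norm of \<open>pq\<close> equal to m times
  \<open>spread\<close>, while it is at most k times \<open>spread\<close>; so
  \<open>spread = 0\<close> or m = k. In the latter case the defect vanishes, and if
  \<open>gbar\<close> were nonzero, all rows of \<open>Q\<close> would be multiples of it. Then
  \<open>Q\<close> would have rank one, giving m = k = 1, which the third assumption
  excludes.\<close>

lemma cost_bound_eq_cases:
  assumes k: "trace Q > 0" "trace Q \<le> trace P" "trace Q \<noteq> 1 \<or> trace Q < trace P"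
    and eq: "(trace P + 1) * cost = trace P * trace Q / real CARD('n)"
  shows "spread = 0 \<or> trace P = trace Q \<and> qp = 0"
proof (rule ccontr)
  assume neg: "\<not> ?thesis"
  let ?Y = "(norm pq)\<^sup>2" and ?k = "trace Q"
  have Y: "?Y = trace P * spread"
    using norm_qp_pq norm_qp_spread k eq by (simp add: algebra_simps)
  have spos: "spread > 0" using neg spread_nonneg by simp
  have "trace P * spread \<le> trace Q * spread" using norm_pq_le[OF k(1)] Y by simp
  then have km: "trace P = trace Q" using spos k by simp
  then have gb: "gbar \<noteq> 0" using neg k by (auto simp: gbar_def qp_def)
  have Ypos: "?Y > 0" using Y spos k by simp
  have "(\<Sum>u\<in>UNIV. (norm (?k *\<^sub>R pq $ u *\<^sub>R (Q $ u - gbar) - ?Y *\<^sub>R Q $ u))\<^sup>2)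
     \<le> ?k\<^sup>2 * (?Y * spread) - ?k * (norm pq)^4"
    unfolding norm_pq_defect by (intro diff_right_mono mult_left_mono sum_pq_comp_le) auto
  also have "\<dots> = (?k * ?Y) * (?k * spread - ?Y)"
    by (simp add: power2_eq_square power4_eq_xxxx algebra_simps)
  also have "\<dots> = 0" using Y km by simp
  finally have "(\<Sum>u\<in>UNIV. (norm (?k *\<^sub>R pq $ u *\<^sub>R (Q $ u - gbar) - ?Y *\<^sub>R Q $ u))\<^sup>2) = 0"
    by (meson antisym sum_nonneg zero_le_power2)
  then have eqs: "?k *\<^sub>R pq $ u *\<^sub>R (Q $ u - gbar) = ?Y *\<^sub>R Q $ u" for u
    by (subst (asm) sum_nonneg_eq_0_iff) auto
  have par: "\<exists>s. Q $ u = s *\<^sub>R gbar" for u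
  proof -
    have *: "(?k * pq $ u - ?Y) *\<^sub>R Q $ u = (?k * pq $ u) *\<^sub>R gbar"
      using eqs[of u] by (simp add: algebra_simps)
    let ?d = "?k * pq $ u - ?Y"
    \<comment> \<open>If this factor were 0, then \<open>*\<close> would force
      \<open>?k * pq $ u = 0\<close> because \<open>gbar\<close> is nonzero, and the factor would be
      \<open>- ?Y\<close>, which is not 0.\<close>
    have d: "?d \<noteq> 0" using * gb Ypos by auto
    have "Q $ u = (1 / ?d) *\<^sub>R (?d *\<^sub>R Q $ u)" using d by simp
    also have "\<dots> = ((1 / ?d) * (?k * pq $ u)) *\<^sub>R gbar" unfolding * by simp
    finally have "Q $ u = ((1 / ?d) * (?k * pq $ u)) *\<^sub>R gbar" .
    then show ?thesis ..
  qed
  then obtain s where s: "Q $ u = s u *\<^sub>R gbar" for u by metis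
  have "Q $ u $ v = s u * s v * (gbar \<bullet> gbar)" for u v
  proof -
    have "Q $ u $ v = Q $ u \<bullet> Q $ v" by (simp add: sym_idem_inner Q)
    then show ?thesis unfolding s[of u] s[of v] by simp
  qed
  then have "(Q $ u $ v)\<^sup>2 = Q $ u $ u * Q $ v $ v" for u v
    by (simp add: power2_eq_square)
  \<comment> \<open>Summed over all u and v, the squared entries give \<open>trace Q\<close>, and
    the products of diagonal entries give its square.\<close>
  then have "trace Q = trace Q * trace Q"
    using trace_sym_idem_square[OF Q] by (simp add: trace_def sum_product)
  then show False using k km by simp
qed

lemma spread_zero:
  assumes "spread = 0" "P $ u $ u \<noteq> 0" "P $ v $ v \<noteq> 0"
  shows "Q $ u = Q $ v"
proof -
  have "\<forall>u. P $ u $ u * (norm (Q $ u - gbar))\<^sup>2 = 0"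
    using assms(1) unfolding spread_def
    by (subst (asm) sum_nonneg_eq_0_iff) (auto intro!: mult_nonneg_nonneg sym_idem_diag_nonneg P)
  then show ?thesis using assms(2,3) by (metis mult_eq_0_iff norm_eq_zero power_eq_0_iff right_minus_eq)
qed

text \<open>If the first case fails, then m = k and \<open>qp = 0\<close>, so the whole sum in
  \<open>norm_qp_pq\<close> is carried by \<open>pq\<close>, which is the \<open>qp\<close> of the
  swapped splitting. Comparing with \<open>norm_qp_spread\<close> there shows that the swapped
  \<open>spread\<close> is 0.\<close>

lemma cost_bound_eq:
  assumes "trace Q > 0" "trace Q \<le> trace P" "trace Q \<noteq> 1 \<or> trace Q < trace P"
    and "(trace P + 1) * cost = trace P * trace Q / real CARD('n)"
  shows "(\<forall>u v. P $ u $ u \<noteq> 0 \<longrightarrow> P $ v $ v \<noteq> 0 \<longrightarrow> Q $ u = Q $ v) \<or>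
    trace P = trace Q \<and> (\<forall>u v. Q $ u $ u \<noteq> 0 \<longrightarrow> Q $ v $ v \<noteq> 0 \<longrightarrow> P $ u = P $ v)"
proof -
  interpret sw: simplex_splitting Q P by (rule swapped)
  show ?thesis
  proof (cases "spread = 0")
    case True
    then show ?thesis using spread_zero by blast
  next
    case False
    then have km: "trace P = trace Q" and qp: "qp = 0"
      using cost_bound_eq_cases assms by auto
    have "(norm sw.qp)\<^sup>2 = trace P * trace Q / real CARD('n) - cost"
      using norm_qp_pq qp sw.qp_swapped by simp
    also have "\<dots> = trace Q * cost" using assms(4) km by (simp add: algebra_simps)
    finally have "trace Q * sw.spread = 0"
      using sw.norm_qp_spread assms(1) by (simp add: cost_swapped)
    then have "sw.spread = 0" using assms(1) by simp
    then show ?thesis using sw.spread_zero km by blast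
  qed
qed

text \<open>Take \<open>C\<close> to be the support of \<open>P\<close>. On \<open>C\<close> the
  entries of \<open>Q\<close> are one constant, so those of \<open>P\<close> are the identity minus
  a constant. Since the rows of \<open>P\<close> sum to 0, that constant is 1 over the size of
  \<open>C\<close>: \<open>P\<close> is the centering matrix of \<open>C\<close>, of rank one less
  than that size.\<close>

lemma constant_rows:
  assumes tr: "trace P > 0"
    and const: "\<forall>u v. P $ u $ u \<noteq> 0 \<longrightarrow> P $ v $ v \<noteq> 0 \<longrightarrow> Q $ u = Q $ v"
  shows "\<exists>C. real (card C) = trace P + 1 \<and> (\<forall>u. P $ u \<noteq> 0 \<longleftrightarrow> u \<in> C) \<and>
    (\<forall>u w. u \<notin> C \<longrightarrow> u \<noteq> w \<longrightarrow> Q $ u $ w = - 1 / real CARD('n)) \<and>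
    (\<forall>u w. u \<in> C \<longrightarrow> w \<in> C \<longrightarrow> u \<noteq> w \<longrightarrow> P $ u $ w = - 1 / real (card C))"
proof -
  define C where "C = {u. P $ u \<noteq> 0}"
  have Pu: "P $ u $ u \<noteq> 0 \<longleftrightarrow> u \<in> C" for u
    by (simp add: C_def sym_idem_diag_zero_iff P)
  have P0: "P $ u $ w = 0" if "u \<notin> C \<or> w \<notin> C" for u w
    using that sym_idem_commute[OF P, of u w] by (auto simp: C_def)
  have "C \<noteq> {}" using tr Pu by (auto simp: trace_def)
  then obtain c where c: "c \<in> C" by blast
  define \<gamma> where "\<gamma> = Q $ c $ c"
  have Q: "Q $ u $ w = \<gamma>" if "u \<in> C" "w \<in> C" for u w
  proof -
    have "Q $ u $ w = Q $ c $ w" using const[rule_format, of u c] that c Pu by simp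
    also have "\<dots> = Q $ w $ c" by (rule sym_idem_commute[OF Q])
    also have "\<dots> = \<gamma>" using const[rule_format, of w c] that c Pu by (simp add: \<gamma>_def)
    finally show ?thesis .
  qed
  have PC: "P $ u $ w = (if u = w then 1 else 0) - 1 / real CARD('n) - \<gamma>" if "u \<in> C" "w \<in> C" for u w
    using splits[of u w] Q[OF that] by simp
  have "0 = (\<Sum>w\<in>C. P $ c $ w)"
    using sum_row[of c] P0[of c] by (subst sum.mono_neutral_left[of UNIV C]) auto
  also have "\<dots> = (\<Sum>w\<in>C. (if c = w then 1 else 0) - (1 / real CARD('n) + \<gamma>))"
    using PC[OF c] by (intro sum.cong) auto
  also have "\<dots> = 1 - real (card C) * (1 / real CARD('n) + \<gamma>)"
    using c by (simp add: sum_subtractf)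
  finally have g: "real (card C) * (1 / real CARD('n) + \<gamma>) = 1" by simp
  then have g': "1 / real CARD('n) + \<gamma> = 1 / real (card C)"
    by (metis mult_eq_0_iff nonzero_mult_div_cancel_left zero_neq_one)
  have "trace P = (\<Sum>u\<in>C. P $ u $ u)"
    unfolding trace_def using Pu by (intro sum.mono_neutral_right) auto
  also have "\<dots> = (\<Sum>u\<in>C. 1 - 1 / real (card C))"
  proof (intro sum.cong refl)
    fix u assume "u \<in> C"
    from PC[OF this this] show "P $ u $ u = 1 - 1 / real (card C)" using g' by simp
  qed
  also have "\<dots> = real (card C) - 1"
    using g by (auto simp: field_simps)
  finally have "real (card C) = trace P + 1" by simp
  moreover have "Q $ u $ w = - 1 / real CARD('n)" if "u \<notin> C" "u \<noteq> w" for u w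
    using splits[of u w] P0[of u w] that by simp
  moreover have "P $ u $ w = - 1 / real (card C)" if "u \<in> C" "w \<in> C" "u \<noteq> w" for u w
    using PC[OF that(1,2)] that(3) g' by (simp add: algebra_simps)
  ultimately show ?thesis by (intro exI[of _ C]) (auto simp: C_def)
qed

end


section \<open>Spectral decomposition\<close>

text \<open>Maximize the Rayleigh quotient over the unit sphere of \<open>W\<close>. With \<mu> its
  maximum at x, the operator \<open>B\<close>, which is \<mu> minus \<open>M\<close>, is positive
  semidefinite on \<open>W\<close>, and its form vanishes at x; a small step from x along
  \<open>B x\<close> shows \<open>B x = 0\<close>.\<close>

lemma ex_eigenvector_in_invariant_subspace:
  fixes M :: "real^'n^'n"
  assumes sym: "transpose M = M" and W: "subspace W" "\<And>x. x \<in> W \<Longrightarrow> M *v x \<in> W"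
    and w: "w \<in> W" "w \<noteq> 0"
  shows "\<exists>x\<in>W. \<exists>\<mu>. x \<noteq> 0 \<and> M *v x = \<mu> *\<^sub>R x"
proof -
  let ?K = "W \<inter> sphere 0 1" and ?f = "\<lambda>x. x \<bullet> (M *v x)"
  have "compact ?K"
    using W(1) by (simp add: closed_Int_compact closed_subspace)
  moreover have "(1 / norm w) *\<^sub>R w \<in> ?K"
    using w W(1) by (simp add: subspace_scale)
  then have "?K \<noteq> {}" by blast
  moreover have "continuous_on ?K ?f"
    by (intro continuous_on_inner continuous_on_id matrix_vector_mult_linear_continuous_on)
  ultimately obtain x where x: "x \<in> ?K" and max: "\<And>y. y \<in> ?K \<Longrightarrow> ?f y \<le> ?f x"
    using continuous_attains_sup[of ?K ?f] by blast
  define \<mu> where "\<mu> = ?f x"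
  define B where "B y = \<mu> *\<^sub>R y - M *v y" for y
  have xx: "x \<bullet> x = 1" using x by (simp add: norm_eq_1)
  have nonneg: "0 \<le> y \<bullet> B y" if y: "y \<in> W" for y
  proof (cases "y = 0")
    case False
    have "(1 / norm y) *\<^sub>R y \<in> ?K" using False y W(1) by (simp add: subspace_scale)
    from max[OF this] have "?f y / (norm y)\<^sup>2 \<le> \<mu>"
      by (simp add: matrix_vector_mult_scaleR \<mu>_def power2_eq_square)
    then have "?f y \<le> \<mu> * (y \<bullet> y)"
      using False by (simp add: divide_le_eq power2_norm_eq_inner)
    then show ?thesis by (simp add: B_def inner_diff_right)
  qed (simp add: B_def)
  have d: "B x \<in> W" using x W by (simp add: B_def subspace_diff subspace_scale)
  have xBx: "x \<bullet> B x = 0" by (simp add: B_def inner_diff_right xx \<mu>_def)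
  have symB: "y \<bullet> B z = B y \<bullet> z" for y z
    using symmetric_inner[OF sym, of y z] by (simp add: B_def inner_diff_left inner_diff_right)
  have Badd: "B (y + t *\<^sub>R z) = B y + t *\<^sub>R B z" for y z t
    by (simp add: B_def matrix_vector_right_distrib matrix_vector_mult_scaleR algebra_simps)
  have "B x = 0"
  proof (rule ccontr)
    assume "B x \<noteq> 0"
    define a where "a = B x \<bullet> B x"
    define c where "c = B x \<bullet> B (B x)"
    have a: "a > 0" using \<open>B x \<noteq> 0\<close> by (simp add: a_def)
    have c: "c \<ge> 0" using nonneg[OF d] by (simp add: c_def)
    \<comment> \<open>The form at \<open>x + t *\<^sub>R B x\<close> is
      \<open>t * (2 * a + t * c)\<close>. This negative t satisfies \<open>t * c >= - a\<close>, so
      the value would be negative; the added 1 covers c = 0.\<close>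
    define t where "t = - a / (c + 1)"
    have t: "t < 0" using a c by (simp add: t_def divide_neg_pos)
    have "0 \<le> (x + t *\<^sub>R B x) \<bullet> B (x + t *\<^sub>R B x)"
      using nonneg[of "x + t *\<^sub>R B x"] x d W(1) by (simp add: subspace_add subspace_scale)
    also have "\<dots> = t * (2 * a + t * c)"
      using symB[of x "B x"]
      by (simp add: Badd inner_add_left inner_add_right xBx a_def c_def algebra_simps)
    finally have "2 * a + t * c \<le> 0" using t by (simp add: zero_le_mult_iff)
    moreover have "t * c \<ge> - a"
      using a c by (simp add: t_def field_simps)
    ultimately show False using a by simp
  qed
  then have "M *v x = \<mu> *\<^sub>R x" by (simp add: B_def)
  moreover have "x \<noteq> 0" using xx by auto
  ultimately show ?thesis using x by blast
qed

lemma symmetric_inner_imp_transpose: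
  fixes P :: "real^'n^'n"
  assumes "\<And>x y. (P *v x) \<bullet> y = x \<bullet> (P *v y)"
  shows "transpose P = P"
proof -
  have "(transpose P *v x) \<bullet> y = (P *v x) \<bullet> y" for x y
    by (simp add: transpose_matrix_vector dot_lmul_matrix assms)
  then have "transpose P *v x = P *v x" for x
    by (metis vector_eq_rdot)
  then show ?thesis by (simp add: matrix_eq)
qed

section \<open>The trace of a symmetric idempotent as a substitute for its rank\<close>

lemma sym_idem_unit_fixed:
  assumes "sym_idem P" "P \<noteq> 0"
  obtains x where "norm x = 1" "P *v x = x"
proof -
  obtain y where y: "P *v y \<noteq> 0"
    using assms(2) by (metis matrix_eq matrix_vector_mult_0)
  show ?thesis
  proof (rule that)
    show "norm ((1 / norm (P *v y)) *\<^sub>R (P *v y)) = 1" using y by simp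
    have "P *v (P *v y) = P *v y"
      using assms(1) by (simp add: matrix_vector_mul_assoc sym_idem_def)
    then show "P *v ((1 / norm (P *v y)) *\<^sub>R (P *v y)) = (1 / norm (P *v y)) *\<^sub>R (P *v y)"
      by (simp add: matrix_vector_mult_scaleR)
  qed
qed

text \<open>For a unit vector x fixed by \<open>P\<close>, the coordinate \<open>x $ u\<close> is
  the inner product of \<open>P $ u\<close> and x, so its square is at most \<open>P $ u $ u\<close>
  by Cauchy-Schwarz. Summing over u gives 1 on the left.\<close>

lemma sym_idem_trace_ge_1:
  assumes "sym_idem P" "P \<noteq> 0"
  shows "trace P \<ge> 1"
proof -
  obtain x where x: "norm x = 1" "P *v x = x" using sym_idem_unit_fixed assms by blast
  have "(x $ u)\<^sup>2 \<le> P $ u $ u" for u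
  proof -
    have "x $ u = P $ u \<bullet> x"
      by (subst x(2)[symmetric]) (simp add: matrix_vector_mult_def inner_vec_def)
    then have "\<bar>x $ u\<bar> \<le> norm (P $ u)"
      using Cauchy_Schwarz_ineq2[of "P $ u" x] x(1) by simp
    then have "(x $ u)\<^sup>2 \<le> (norm (P $ u))\<^sup>2"
      using abs_le_square_iff[of "x $ u" "norm (P $ u)"] by simp
    then show ?thesis by (simp add: sym_idem_diag assms(1))
  qed
  then have "(\<Sum>u\<in>UNIV. (x $ u)\<^sup>2) \<le> trace P"
    unfolding trace_def by (intro sum_mono)
  moreover have "(\<Sum>u\<in>UNIV. (x $ u)\<^sup>2) = (norm x)\<^sup>2"
    unfolding power2_norm_eq_inner inner_vec_def by (simp add: power2_eq_square)
  ultimately show ?thesis using x(1) by simp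
qed

text \<open>Subtracting the projection onto a fixed unit vector leaves a symmetric idempotent
  \<open>R\<close> with trace smaller by 1. Either \<open>R\<close> is 0, and \<open>P\<close> has
  rank one, or \<open>R\<close> again has trace at least 1.\<close>

lemma sym_idem_rank_one_or_trace_ge_2:
  assumes P: "sym_idem P" "P \<noteq> 0"
  shows "(\<exists>x. norm x = 1 \<and> (\<forall>u v. P $ u $ v = x $ u * x $ v)) \<or> trace P \<ge> 2"
proof -
  obtain x where x: "norm x = 1" "P *v x = x" using sym_idem_unit_fixed P by blast
  have xx: "(\<Sum>u\<in>UNIV. x $ u * x $ u) = 1"
    using x(1) unfolding norm_eq_1 inner_vec_def by simp
  define R where "R = P - (\<chi> u v. x $ u * x $ v)"
  have Px: "(\<Sum>v\<in>UNIV. P $ u $ v * x $ v) = x $ u" for u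
    using x(2) by (simp add: vec_eq_iff matrix_vector_mult_def)
  have xP: "(\<Sum>v\<in>UNIV. x $ v * P $ v $ u) = x $ u" for u
    using Px[of u] sym_idem_commute[OF P(1), of u] by (simp add: mult.commute)
  have PP: "(\<Sum>w\<in>UNIV. P $ u $ w * P $ w $ v) = P $ u $ v" for u v
  proof -
    have "(P ** P) $ u $ v = P $ u $ v" using P(1) by (simp add: sym_idem_def)
    then show ?thesis by (simp add: matrix_matrix_mult_def)
  qed
  have "sym_idem R"
    unfolding sym_idem_def
  proof
    show "transpose R = R"
      by (simp add: R_def transpose_def vec_eq_iff sym_idem_commute[OF P(1)] mult.commute)
    have "(\<Sum>w\<in>UNIV. (P $ u $ w - x $ u * x $ w) * (P $ w $ v - x $ w * x $ v))
       = P $ u $ v - x $ u * x $ v" for u v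
    proof -
      have "(\<Sum>w\<in>UNIV. (P $ u $ w - x $ u * x $ w) * (P $ w $ v - x $ w * x $ v))
        = (\<Sum>w\<in>UNIV. P $ u $ w * P $ w $ v) - (\<Sum>w\<in>UNIV. P $ u $ w * x $ w) * x $ v
          - x $ u * (\<Sum>w\<in>UNIV. x $ w * P $ w $ v)
          + x $ u * (\<Sum>w\<in>UNIV. x $ w * x $ w) * x $ v"
        by (simp add: sum_distrib_left sum_distrib_right sum_subtractf[symmetric]
            sum.distrib[symmetric] algebra_simps)
      then show ?thesis by (simp add: PP Px xP xx)
    qed
    then show "R ** R = R"
      by (simp add: R_def matrix_matrix_mult_def vec_eq_iff)
  qed
  moreover have "trace R = trace P - 1"
    by (simp add: R_def trace_def sum_subtractf xx)
  ultimately have "R = 0 \<or> trace P \<ge> 2"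
    using sym_idem_trace_ge_1[of R] by force
  moreover have "P $ u $ v = x $ u * x $ v" if "R = 0" for u v
    using that by (simp add: R_def vec_eq_iff)
  ultimately show ?thesis using x(1) by blast
qed

section \<open>Spectral theorem for a real symmetric matrix\<close>

locale symmetric_matrix =
  fixes M :: "real^'n^'n"
  assumes symm: "transpose M = M"
begin

abbreviation proj :: "real \<Rightarrow> real^'n^'n" where
  "proj l \<equiv> orth_proj (eigenspace M l)"

lemma proj_in: "M *v (proj l *v x) = l *\<^sub>R (proj l *v x)"
  and proj_orth: "M *v y = l *\<^sub>R y \<Longrightarrow> (x - proj l *v x) \<bullet> y = 0"
  using is_orth_proj_orth_proj[OF subspace_eigenspace[of M l]]
  by (auto simp: is_orth_proj_def eigenspace_def orthogonal_def)

text \<open>The residual lies in the eigenspace and is orthogonal to it, hence to itself.\<close>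

lemma proj_fix:
  assumes "M *v x = l *\<^sub>R x" shows "proj l *v x = x"
proof -
  let ?d = "x - proj l *v x"
  have "M *v ?d = l *\<^sub>R ?d"
    by (simp add: matrix_vector_mult_diff_distrib assms proj_in scaleR_diff_right)
  then have "?d \<bullet> ?d = 0" by (rule proj_orth)
  then show ?thesis by simp
qed

lemma sym_idem_proj: "sym_idem (proj l)"
proof -
  have "(proj l *v x) \<bullet> y = x \<bullet> (proj l *v y)" for x y
  proof -
    have "(x - proj l *v x) \<bullet> (proj l *v y) = 0" "(y - proj l *v y) \<bullet> (proj l *v x) = 0"
      by (intro proj_orth proj_in)+
    then have "x \<bullet> (proj l *v y) = (proj l *v x) \<bullet> (proj l *v y)"
      "y \<bullet> (proj l *v x) = (proj l *v y) \<bullet> (proj l *v x)"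
      unfolding inner_diff_left by simp_all
    then show ?thesis by (metis inner_commute)
  qed
  then have "transpose (proj l) = proj l" by (rule symmetric_inner_imp_transpose)
  moreover have "proj l ** proj l = proj l"
    using proj_fix[OF proj_in] by (simp add: matrix_eq matrix_vector_mul_assoc[symmetric])
  ultimately show ?thesis by (simp add: sym_idem_def)
qed

lemma eigenvectors_orthogonal:
  assumes "M *v x = l *\<^sub>R x" "M *v y = m *\<^sub>R y" "l \<noteq> m" shows "x \<bullet> y = 0"
  using symmetric_inner[OF symm, of x y] assms by simp

lemma proj_mult_proj:
  assumes "l \<noteq> m" shows "proj l ** proj m = 0"
proof -
  have "(proj l *v (proj m *v x)) \<bullet> y = 0" for x y
    using eigenvectors_orthogonal[OF proj_in proj_in] assms sym_idem_proj[of l]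
    by (simp add: symmetric_inner sym_idem_def)
  then have "proj l *v (proj m *v x) = 0" for x
    by (metis inner_eq_zero_iff)
  then show ?thesis by (simp add: matrix_eq matrix_vector_mul_assoc[symmetric])
qed

lemma proj_nonzero:
  assumes "l \<in> eigenvalues M" shows "proj l \<noteq> 0"
proof -
  obtain x where "x \<noteq> 0" "M *v x = l *\<^sub>R x" using assms by (auto simp: eigenvalues_def)
  then show ?thesis using proj_fix by (metis matrix_vector_mult_0)
qed

lemma finite_spectrum: "finite (eigenvalues M)"
  by (rule finite_eigenvalues[OF symm])

lemma sum_matrix_mult_vec: "(\<Sum>l\<in>A. f l) *v x = (\<Sum>l\<in>A. f l *v (x::real^'n))"
  by (induction A rule: infinite_finite_induct) (simp_all add: matrix_vector_mult_add_rdistrib)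

text \<open>The common kernel \<open>W\<close> of all projections is invariant under
  \<open>M\<close>. If it were nonzero it would contain an eigenvector, which its own projection
  fixes instead of killing. Every vector minus the sum of its projections lies in
  \<open>W\<close>.\<close>

lemma sum_proj: "(\<Sum>l\<in>eigenvalues M. proj l) = mat 1"
proof -
  define W where "W = {x. \<forall>l\<in>eigenvalues M. proj l *v x = 0}"
  have W: "subspace W"
    by (auto simp: W_def subspace_def matrix_vector_right_distrib matrix_vector_mult_scaleR)
  have inv: "M *v x \<in> W" if "x \<in> W" for x
  proof -
    have "proj l *v (M *v x) = 0" if l: "l \<in> eigenvalues M" for l
    proof -
      have "(proj l *v (M *v x)) \<bullet> y = 0" for y
      proof -
        have "(proj l *v (M *v x)) \<bullet> y = x \<bullet> (M *v (proj l *v y))"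
          using sym_idem_proj[of l] symm by (simp add: symmetric_inner sym_idem_def)
        also have "\<dots> = l * ((proj l *v x) \<bullet> y)"
          using sym_idem_proj[of l] by (simp add: proj_in symmetric_inner sym_idem_def)
        finally show ?thesis using \<open>x \<in> W\<close> l by (simp add: W_def)
      qed
      then show ?thesis by (metis inner_eq_zero_iff)
    qed
    then show ?thesis by (simp add: W_def)
  qed
  have W0: "x = 0" if xW: "x \<in> W" for x
  proof (rule ccontr)
    assume "x \<noteq> 0"
    then obtain y \<mu> where y: "y \<in> W" "y \<noteq> 0" "M *v y = \<mu> *\<^sub>R y"
      using ex_eigenvector_in_invariant_subspace[OF symm W inv xW] by blast
    then have "\<mu> \<in> eigenvalues M" by (auto simp: eigenvalues_def)
    then show False using y proj_fix by (auto simp: W_def)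
  qed
  have "(\<Sum>l\<in>eigenvalues M. proj l) *v x = x" for x
  proof -
    have "proj m *v (\<Sum>l\<in>eigenvalues M. proj l *v x) = proj m *v x"
      if m: "m \<in> eigenvalues M" for m
    proof -
      have "proj m *v (\<Sum>l\<in>eigenvalues M. proj l *v x)
        = (\<Sum>l\<in>eigenvalues M. proj m *v (proj l *v x))"
        by (simp add: linear_sum[OF matrix_vector_mul_linear])
      also have "\<dots> = (\<Sum>l\<in>eigenvalues M. if l = m then proj m *v x else 0)"
        using proj_mult_proj sym_idem_proj
        by (intro sum.cong) (auto simp: matrix_vector_mul_assoc sym_idem_def)
      finally show ?thesis using m by (simp add: finite_spectrum)
    qed
    then have "x - (\<Sum>l\<in>eigenvalues M. proj l *v x) \<in> W"
      by (simp add: W_def matrix_vector_mult_diff_distrib)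
    then show ?thesis using W0 by (fastforce simp: sum_matrix_mult_vec)
  qed
  then show ?thesis by (simp add: matrix_eq)
qed

lemma spectral_decomposition: "M = (\<Sum>l\<in>eigenvalues M. l *\<^sub>R proj l)"
proof -
  have "M *v x = (\<Sum>l\<in>eigenvalues M. l *\<^sub>R proj l) *v x" for x
  proof -
    have "M *v x = M *v ((\<Sum>l\<in>eigenvalues M. proj l) *v x)" by (simp add: sum_proj)
    also have "\<dots> = (\<Sum>l\<in>eigenvalues M. l *\<^sub>R (proj l *v x))"
      by (simp add: sum_matrix_mult_vec linear_sum[OF matrix_vector_mul_linear] proj_in)
    finally show ?thesis by (simp add: sum_matrix_mult_vec scaleR_matrix_vector_assoc)
  qed
  then show ?thesis by (simp add: matrix_eq)
qed

end


section \<open>The deficit of a Laplacian\<close>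

lemma matrix_sum_component: "(\<Sum>l\<in>A. f l) $ u $ v = (\<Sum>l\<in>A. f l $ u $ v)"
  by (simp add: sum_component)

lemma trace_sum: "trace (\<Sum>l\<in>A. f l) = (\<Sum>l\<in>A. trace (f l :: real^'n^'n))"
  by (simp add: trace_def matrix_sum_component sum.swap[of _ UNIV])

definition extremal_deficit :: "real \<Rightarrow> real" where
  "extremal_deficit n = 4 * (n - 3) / (n * (n - 2))"

text \<open>The value (n - 2)/n is the lower bound arising for spectra that cannot be grouped. It
  exceeds the extremal one by (n - 4)^2 / (n (n - 2)), so the two meet only at n = 4.\<close>

lemma extremal_deficit_le:
  assumes "n \<ge> 4"
  shows "extremal_deficit n \<le> (n - 2) / n" "extremal_deficit n = (n - 2) / n \<longleftrightarrow> n = 4"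
proof -
  have *: "(n - 2) / n - extremal_deficit n = (n - 4)\<^sup>2 / (n * (n - 2))"
    using assms by (simp add: extremal_deficit_def field_simps power2_eq_square)
  have "(n - 4)\<^sup>2 / (n * (n - 2)) \<ge> 0" using assms by (intro divide_nonneg_pos) auto
  then show "extremal_deficit n \<le> (n - 2) / n" using * by simp
  have "extremal_deficit n = (n - 2) / n \<longleftrightarrow> (n - 4)\<^sup>2 / (n * (n - 2)) = 0"
    unfolding *[symmetric] by auto
  also have "\<dots> \<longleftrightarrow> n = 4" using assms by simp
  finally show "extremal_deficit n = (n - 2) / n \<longleftrightarrow> n = 4" .
qed

text \<open>The right side is twice the bound of \<open>cost_bound\<close> for classes of traces m
  and k. After substituting n = k + m + 1 the difference has the factor k - 2, the other factors
  being positive.\<close>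

lemma extremal_deficit_le_traces:
  assumes "k \<ge> 2" "k \<le> m" "n = k + m + 1"
  shows "extremal_deficit n \<le> 2 * (m * k / n / (m + 1))"
    "extremal_deficit n = 2 * (m * k / n / (m + 1)) \<longleftrightarrow> k = 2"
proof -
  have pos: "n * (n - 2) * (m + 1) > 0" using assms by simp
  have *: "2 * (m * k / n / (m + 1)) - extremal_deficit n
      = 2 * (k - 2) * (m * (n - 2) - 2) / (n * (n - 2) * (m + 1))"
  proof -
    have "n > 0" "n - 2 > 0" "m + 1 > 0" using assms by auto
    then have "2 * (m * k / n / (m + 1)) - extremal_deficit n
      = (2 * m * k * (n - 2) - 4 * (n - 3) * (m + 1)) / (n * (n - 2) * (m + 1))"
      by (simp add: extremal_deficit_def divide_simps)
    also have "2 * m * k * (n - 2) - 4 * (n - 3) * (m + 1) = 2 * (k - 2) * (m * (n - 2) - 2)"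
      unfolding assms(3) by (simp add: algebra_simps)
    finally show ?thesis .
  qed
  have "m * (n - 2) \<ge> 2 * 3" using assms by (intro mult_mono) auto
  then have m: "m * (n - 2) - 2 > 0" by simp
  have "2 * (k - 2) * (m * (n - 2) - 2) / (n * (n - 2) * (m + 1)) \<ge> 0"
    using m pos assms(1) by (intro divide_nonneg_pos mult_nonneg_nonneg) auto
  then show "extremal_deficit n \<le> 2 * (m * k / n / (m + 1))" using * by simp
  have "extremal_deficit n = 2 * (m * k / n / (m + 1)) \<longleftrightarrow>
      2 * (k - 2) * (m * (n - 2) - 2) / (n * (n - 2) * (m + 1)) = 0"
    unfolding *[symmetric] by auto
  also have "\<dots> \<longleftrightarrow> k = 2" using m pos by auto
  finally show "extremal_deficit n = 2 * (m * k / n / (m + 1)) \<longleftrightarrow> k = 2" .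
qed

text \<open>The difference of the two sides is the sum of all cross products of distinct terms.
  These are nonnegative, so equality makes each of them 0.\<close>

lemma sum_power2_le:
  fixes f :: "'b \<Rightarrow> real"
  assumes "finite A" "\<And>x. x \<in> A \<Longrightarrow> f x \<ge> 0"
  shows "(\<Sum>x\<in>A. (f x)\<^sup>2) \<le> (\<Sum>x\<in>A. f x)\<^sup>2"
    "(\<Sum>x\<in>A. (f x)\<^sup>2) = (\<Sum>x\<in>A. f x)\<^sup>2 \<Longrightarrow> x \<in> A \<Longrightarrow> y \<in> A \<Longrightarrow> x \<noteq> y \<Longrightarrow> f x * f y = 0"
proof -
  have split: "(\<Sum>x\<in>A. f x)\<^sup>2 - (\<Sum>x\<in>A. (f x)\<^sup>2) = (\<Sum>x\<in>A. \<Sum>y\<in>A - {x}. f x * f y)"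
  proof -
    have "(\<Sum>x\<in>A. f x)\<^sup>2 = (\<Sum>x\<in>A. \<Sum>y\<in>A. f x * f y)"
      by (simp add: power2_eq_square sum_product)
    also have "\<dots> = (\<Sum>x\<in>A. (f x)\<^sup>2 + (\<Sum>y\<in>A - {x}. f x * f y))"
      using assms(1) by (intro sum.cong refl) (simp add: sum.remove power2_eq_square)
    finally show ?thesis by (simp add: sum.distrib)
  qed
  have nn: "0 \<le> (\<Sum>y\<in>A - {x}. f x * f y)" if "x \<in> A" for x
    using assms(2) that by (intro sum_nonneg mult_nonneg_nonneg) auto
  then have "0 \<le> (\<Sum>x\<in>A. \<Sum>y\<in>A - {x}. f x * f y)" by (rule sum_nonneg)
  then show "(\<Sum>x\<in>A. (f x)\<^sup>2) \<le> (\<Sum>x\<in>A. f x)\<^sup>2" using split by simp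
  assume "(\<Sum>x\<in>A. (f x)\<^sup>2) = (\<Sum>x\<in>A. f x)\<^sup>2" and xy: "x \<in> A" "y \<in> A" "x \<noteq> y"
  then have "(\<Sum>x\<in>A. \<Sum>y\<in>A - {x}. f x * f y) = 0" using split by simp
  then have "\<forall>x\<in>A. (\<Sum>y\<in>A - {x}. f x * f y) = 0"
    using sum_nonneg_eq_0_iff[of A "\<lambda>x. \<Sum>y\<in>A - {x}. f x * f y"] assms(1) nn by blast
  then have "(\<Sum>y\<in>A - {x}. f x * f y) = 0" using xy by blast
  then have "\<forall>y\<in>A - {x}. f x * f y = 0"
    using assms xy by (subst (asm) sum_nonneg_eq_0_iff) (auto intro!: mult_nonneg_nonneg)
  then show "f x * f y = 0" using xy by blast
qed

text \<open>This is the spectral form of connectedness: for the Laplacian of a connected graph the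
  kernel consists of the constants, whose projection is J/n
  (\<open>kernel_constant_L\<close>).\<close>

locale kernel_constant = symmetric_matrix M for M :: "real^'n^'n" +
  assumes proj_0: "proj 0 $ u $ v = 1 / real CARD('n)"
begin

abbreviation spec :: "real set" where "spec \<equiv> eigenvalues M - {0}"

definition grp :: "real set \<Rightarrow> real^'n^'n" where "grp A = (\<Sum>l\<in>A. proj l)"

definition deficit :: real where
  "deficit = (\<Sum>u\<in>UNIV. (1 - 1 / real CARD('n))\<^sup>2 - (\<Sum>l\<in>spec. (proj l $ u $ u)\<^sup>2))"

lemma finite_spec: "finite spec"
  by (simp add: finite_spectrum)

lemma zero_in_eigenvalues: "0 \<in> eigenvalues M"
proof -
  have "proj 0 *v 1 = 1"
    by (simp add: vec_eq_iff matrix_vector_mult_def proj_0)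
  then have "M *v 1 = 0 *\<^sub>R 1" using proj_in[of 0 1] by simp
  moreover have "(1 :: real^'n) \<noteq> 0" by (simp add: vec_eq_iff)
  ultimately show ?thesis unfolding eigenvalues_def by blast
qed

lemma grp_mult_grp:
  assumes "finite A" "finite B"
  shows "grp A ** grp B = grp (A \<inter> B)"
proof -
  have "grp A *v (grp B *v x) = grp (A \<inter> B) *v x" for x
  proof -
    have "grp A *v (grp B *v x) = (\<Sum>l\<in>A. \<Sum>m\<in>B. proj l *v (proj m *v x))"
      by (simp add: grp_def sum_matrix_mult_vec linear_sum[OF matrix_vector_mul_linear])
        (rule sum.swap)
    also have "\<dots> = (\<Sum>l\<in>A. \<Sum>m\<in>B. if m = l then proj l *v x else 0)"
      using proj_mult_proj sym_idem_proj
      by (intro sum.cong) (auto simp: matrix_vector_mul_assoc sym_idem_def)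
    also have "\<dots> = (\<Sum>l\<in>A. if l \<in> B then proj l *v x else 0)"
      using assms(2) by (intro sum.cong) (auto simp: sum.delta)
    also have "\<dots> = (\<Sum>l\<in>A \<inter> B. proj l *v x)"
      by (rule sum.inter_restrict[OF assms(1), symmetric])
    also have "\<dots> = grp (A \<inter> B) *v x"
      by (simp add: grp_def sum_matrix_mult_vec)
    finally show ?thesis .
  qed
  then show ?thesis by (simp add: matrix_eq matrix_vector_mul_assoc[symmetric])
qed

lemma sym_idem_grp: "finite A \<Longrightarrow> sym_idem (grp A)"
  using grp_mult_grp[of A A] sym_idem_commute[OF sym_idem_proj]
  by (simp add: sym_idem_def) (simp add: vec_eq_iff transpose_def grp_def matrix_sum_component)

lemma grp_singleton: "grp {l} = proj l"
  by (simp add: grp_def)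

lemma grp_spec: "grp spec $ u $ v = (if u = v then 1 else 0) - 1 / real CARD('n)"
proof -
  have "mat 1 = proj 0 + grp spec"
    unfolding grp_def sum_proj[symmetric]
    by (simp add: sum.remove[OF finite_spectrum zero_in_eigenvalues])
  then have "(mat 1 :: real^'n^'n) $ u $ v = proj 0 $ u $ v + grp spec $ u $ v" by simp
  then show ?thesis by (simp add: mat_def proj_0)
qed

lemma grp_Un: "finite A \<Longrightarrow> finite B \<Longrightarrow> A \<inter> B = {} \<Longrightarrow> grp (A \<union> B) = grp A + grp B"
  by (simp add: grp_def sum.union_disjoint)

lemma splitting:
  assumes "A \<union> B = spec" "A \<inter> B = {}"
  shows "simplex_splitting (grp A) (grp B)"
proof -
  have fin: "finite A" "finite B" using assms(1) finite_spec by (metis finite_Un)+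
  show ?thesis
  proof
    show "sym_idem (grp A)" "sym_idem (grp B)" using fin by (simp_all add: sym_idem_grp)
    show "grp A ** grp B = 0" using fin assms(2) by (simp add: grp_mult_grp) (simp add: grp_def)
    show "grp A $ u $ v + grp B $ u $ v = (if u = v then 1 else 0) - 1 / real CARD('n)" for u v
      using grp_spec[of u v] grp_Un[OF fin assms(2)] assms(1) by simp
  qed
qed

text \<open>At each vertex the entries p of the projections add up to c = 1 - 1/n, so c^2 minus
  their squares is the sum of all (c - p) p. Here c - p is the entry of the complementary group.
  This form uses the splittings at all eigenvalues simultaneously.\<close>

lemma deficit_eq_sum_cost:
  "deficit = (\<Sum>l\<in>spec. simplex_splitting.cost (grp (spec - {l})) (proj l))"
proof -
  have sp: "simplex_splitting (grp (spec - {l})) (proj l)" if "l \<in> spec" for l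
    using splitting[of "spec - {l}" "{l}"] that by (simp add: grp_singleton insert_absorb)
  have sum1: "(\<Sum>l\<in>spec. proj l $ u $ u) = 1 - 1 / real CARD('n)" for u
    using grp_spec[of u u] by (simp add: grp_def matrix_sum_component)
  have "deficit = (\<Sum>u\<in>UNIV. \<Sum>l\<in>spec. (1 - 1 / real CARD('n) - proj l $ u $ u) * proj l $ u $ u)"
    unfolding deficit_def
  proof (intro sum.cong refl)
    fix u
    have "(1 - 1 / real CARD('n))\<^sup>2 = (1 - 1 / real CARD('n)) * (\<Sum>l\<in>spec. proj l $ u $ u)"
      unfolding sum1 by (simp add: power2_eq_square)
    then show "(1 - 1 / real CARD('n))\<^sup>2 - (\<Sum>l\<in>spec. (proj l $ u $ u)\<^sup>2)
      = (\<Sum>l\<in>spec. (1 - 1 / real CARD('n) - proj l $ u $ u) * proj l $ u $ u)"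
      by (simp only: sum_distrib_left left_diff_distrib power2_eq_square sum_subtractf)
  qed
  also have "\<dots> = (\<Sum>l\<in>spec. \<Sum>u\<in>UNIV. grp (spec - {l}) $ u $ u * proj l $ u $ u)"
  proof (subst sum.swap, intro sum.cong refl)
    fix l u assume "l \<in> spec"
    then have "1 - 1 / real CARD('n) - proj l $ u $ u = grp (spec - {l}) $ u $ u"
      using simplex_splitting.diag_add[OF sp, of l u] by simp
    then show "(1 - 1 / real CARD('n) - proj l $ u $ u) * proj l $ u $ u = grp (spec - {l}) $ u $ u * proj l $ u $ u"
      by simp
  qed
  also have "\<dots> = (\<Sum>l\<in>spec. simplex_splitting.cost (grp (spec - {l})) (proj l))"
    by (intro sum.cong refl) (simp add: simplex_splitting.cost_def[OF sp])
  finally show ?thesis .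
qed

text \<open>Expand the square of the constant diagonal sum of both groups: the mixed term gives
  twice the cost, and what remains is the excess within each group.\<close>

lemma deficit_split:
  assumes "A \<union> B = spec" "A \<inter> B = {}"
  shows "deficit = 2 * simplex_splitting.cost (grp A) (grp B)
    + (\<Sum>u\<in>UNIV. (grp A $ u $ u)\<^sup>2 - (\<Sum>l\<in>A. (proj l $ u $ u)\<^sup>2))
    + (\<Sum>u\<in>UNIV. (grp B $ u $ u)\<^sup>2 - (\<Sum>l\<in>B. (proj l $ u $ u)\<^sup>2))"
proof -
  interpret sp: simplex_splitting "grp A" "grp B" by (rule splitting[OF assms])
  have fin: "finite A" "finite B" using assms(1) finite_spec by (metis finite_Un)+
  show ?thesis
    unfolding deficit_def sp.cost_def sum_distrib_left sum.distrib[symmetric]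
  proof (intro sum.cong refl)
    fix u
    have "(\<Sum>l\<in>spec. (proj l $ u $ u)\<^sup>2) = (\<Sum>l\<in>A. (proj l $ u $ u)\<^sup>2) + (\<Sum>l\<in>B. (proj l $ u $ u)\<^sup>2)"
      unfolding assms(1)[symmetric] using fin assms(2) by (rule sum.union_disjoint)
    moreover have "(1 - 1 / real CARD('n))\<^sup>2 = (grp A $ u $ u + grp B $ u $ u)\<^sup>2"
      using sp.diag_add[of u] by simp
    ultimately show "(1 - 1 / real CARD('n))\<^sup>2 - (\<Sum>l\<in>spec. (proj l $ u $ u)\<^sup>2) =
      2 * (grp A $ u $ u * grp B $ u $ u) + ((grp A $ u $ u)\<^sup>2 - (\<Sum>l\<in>A. (proj l $ u $ u)\<^sup>2))
      + ((grp B $ u $ u)\<^sup>2 - (\<Sum>l\<in>B. (proj l $ u $ u)\<^sup>2))"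
      by (simp add: power2_sum)
  qed
qed

text \<open>The excess consists of cross products of diagonal entries within the group. If it
  vanishes, distinct projections of the group have disjoint supports.\<close>

lemma grp_excess:
  assumes "finite A"
  shows "0 \<le> (\<Sum>u\<in>UNIV. (grp A $ u $ u)\<^sup>2 - (\<Sum>l\<in>A. (proj l $ u $ u)\<^sup>2))"
    "(\<Sum>u\<in>UNIV. (grp A $ u $ u)\<^sup>2 - (\<Sum>l\<in>A. (proj l $ u $ u)\<^sup>2)) = 0 \<Longrightarrow>
      l \<in> A \<Longrightarrow> m \<in> A \<Longrightarrow> l \<noteq> m \<Longrightarrow> proj l $ u = 0 \<or> proj m $ u = 0"
proof -
  have nn: "proj l $ u $ u \<ge> 0" for l u by (rule sym_idem_diag_nonneg[OF sym_idem_proj])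
  have g: "grp A $ u $ u = (\<Sum>l\<in>A. proj l $ u $ u)" for u
    by (simp add: grp_def matrix_sum_component)
  have le: "0 \<le> (grp A $ u $ u)\<^sup>2 - (\<Sum>l\<in>A. (proj l $ u $ u)\<^sup>2)" for u
    unfolding g using sum_power2_le(1)[OF assms, of "\<lambda>l. proj l $ u $ u"] nn by simp
  then show "0 \<le> (\<Sum>u\<in>UNIV. (grp A $ u $ u)\<^sup>2 - (\<Sum>l\<in>A. (proj l $ u $ u)\<^sup>2))"
    by (intro sum_nonneg)
  assume "(\<Sum>u\<in>UNIV. (grp A $ u $ u)\<^sup>2 - (\<Sum>l\<in>A. (proj l $ u $ u)\<^sup>2)) = 0"
    and lm: "l \<in> A" "m \<in> A" "l \<noteq> m"
  then have "(grp A $ u $ u)\<^sup>2 - (\<Sum>l\<in>A. (proj l $ u $ u)\<^sup>2) = 0"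
    using le by (subst (asm) sum_nonneg_eq_0_iff) auto
  then have "proj l $ u $ u * proj m $ u $ u = 0"
    unfolding g using sum_power2_le(2)[OF assms, of "\<lambda>l. proj l $ u $ u" l m] nn lm by simp
  then show "proj l $ u = 0 \<or> proj m $ u = 0"
    using sym_idem_diag_zero_iff[OF sym_idem_proj] by simp
qed

text \<open>With zero excess, the row at u comes from a single eigenvalue l. That row is nonzero on
  the whole support of the group, so l is present at each vertex of it, and disjointness of supports
  leaves no vertex for any other eigenvalue.\<close>

lemma grp_is_singleton:
  assumes A: "finite A" "A \<subseteq> eigenvalues M"
    and ex: "(\<Sum>u\<in>UNIV. (grp A $ u $ u)\<^sup>2 - (\<Sum>l\<in>A. (proj l $ u $ u)\<^sup>2)) = 0"
    and u: "grp A $ u \<noteq> 0" "\<And>w. grp A $ w \<noteq> 0 \<Longrightarrow> grp A $ u $ w \<noteq> 0"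
  shows "\<exists>l. A = {l}"
proof -
  have g: "grp A $ w = (\<Sum>l\<in>A. proj l $ w)" for w
    by (simp add: grp_def sum_component)
  obtain l where l: "l \<in> A" "proj l $ u \<noteq> 0"
    using u(1) sum.neutral[of A "\<lambda>l. proj l $ u"] unfolding g by blast
  have others: "proj m $ u = 0" if "m \<in> A" "m \<noteq> l" for m
    using grp_excess(2)[OF A(1) ex that(1) l(1) that(2), of u] l(2) by simp
  have gu: "grp A $ u = proj l $ u"
    unfolding g using A(1) l(1) others by (simp add: sum.remove[of A l])
  have "m = l" if m: "m \<in> A" for m
  proof (rule ccontr)
    assume ml: "m \<noteq> l"
    have "proj m $ w = 0" for w
    proof (cases "grp A $ w = 0")
      case True
      have "(\<Sum>l\<in>A. proj l $ w $ w) = 0"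
        using True by (simp add: grp_def matrix_sum_component[symmetric])
      then have "proj m $ w $ w = 0"
        using A(1) m by (subst (asm) sum_nonneg_eq_0_iff)
          (auto intro: sym_idem_diag_nonneg[OF sym_idem_proj])
      then show ?thesis using sym_idem_diag_zero_iff[OF sym_idem_proj] by blast
    next
      case False
      then have "proj l $ u $ w \<noteq> 0" using u(2) gu by simp
      then have "proj l $ w \<noteq> 0"
        by (metis sym_idem_commute[OF sym_idem_proj] zero_index)
      then show ?thesis using grp_excess(2)[OF A(1) ex m l(1) ml, of w] by simp
    qed
    then have "proj m = 0" by (simp add: vec_eq_iff)
    then show False using proj_nonzero A(2) m by auto
  qed
  then show ?thesis using l(1) by blast
qed

lemma M_eq_sum_spec: "M = (\<Sum>l\<in>spec. l *\<^sub>R proj l)"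
proof -
  have "M = (\<Sum>l\<in>eigenvalues M. l *\<^sub>R proj l)" by (rule spectral_decomposition)
  also have "\<dots> = (\<Sum>l\<in>spec. l *\<^sub>R proj l)"
    by (simp add: sum.remove[OF finite_spectrum zero_in_eigenvalues])
  finally show ?thesis .
qed

text \<open>By \<open>constant_rows\<close>, \<open>grp A\<close> is the centering matrix of a set
  \<open>C\<close> of n - 2 vertices; a and b are the remaining two. Zero excess makes both groups
  single eigenvalues, so \<open>M\<close> is a combination of two explicit projections and its
  entries can be read off.\<close>

lemma two_group_shape:
  assumes AB: "A \<union> B = spec" "A \<inter> B = {}"
    and ex: "(\<Sum>u\<in>UNIV. (grp A $ u $ u)\<^sup>2 - (\<Sum>l\<in>A. (proj l $ u $ u)\<^sup>2)) = 0"
      "(\<Sum>u\<in>UNIV. (grp B $ u $ u)\<^sup>2 - (\<Sum>l\<in>B. (proj l $ u $ u)\<^sup>2)) = 0"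
    and tr: "trace (grp B) = 2" "trace (grp A) > 0"
    and const: "\<forall>u v. grp A $ u $ u \<noteq> 0 \<longrightarrow> grp A $ v $ v \<noteq> 0 \<longrightarrow> grp B $ u = grp B $ v"
  shows "\<exists>a b \<theta> \<delta>. a \<noteq> b \<and> (\<forall>w. w \<noteq> a \<longrightarrow> M $ a $ w = \<theta>) \<and> (\<forall>w. w \<noteq> b \<longrightarrow> M $ b $ w = \<theta>) \<and>
    (\<forall>u w. u \<noteq> w \<longrightarrow> u \<notin> {a, b} \<longrightarrow> w \<notin> {a, b} \<longrightarrow> M $ u $ w = \<delta>)"
proof -
  interpret sp: simplex_splitting "grp A" "grp B" by (rule splitting[OF AB])
  have fin: "finite A" "finite B" using AB(1) finite_spec by (metis finite_Un)+
  from sp.constant_rows[OF tr(2) const] obtain C where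
    C1: "real (card C) = trace (grp A) + 1" "\<forall>u. grp A $ u \<noteq> 0 \<longleftrightarrow> u \<in> C"
    "\<forall>u w. u \<notin> C \<longrightarrow> u \<noteq> w \<longrightarrow> grp B $ u $ w = - 1 / real CARD('n)"
    "\<forall>u w. u \<in> C \<longrightarrow> w \<in> C \<longrightarrow> u \<noteq> w \<longrightarrow> grp A $ u $ w = - 1 / real (card C)"
    by (elim exE conjE) assumption
  note C = C1(1) C1(2-4)[rule_format]
  have "real (card (- C)) = real CARD('n) - real (card C)"
    by (simp add: Compl_eq_Diff_UNIV card_Diff_subset of_nat_diff card_mono)
  also have "\<dots> = 2" using C(1) sp.trace_add tr(1) by simp
  finally have "card (- C) = 2" by simp
  then obtain a b where ab: "- C = {a, b}" "a \<noteq> b" by (auto simp: card_2_iff)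
  then have aC: "a \<notin> C" "b \<notin> C" by auto
  have nC: "card C > 0" using C(1) tr(2) by (metis of_nat_0_less_iff add_pos_pos zero_less_one)
  then obtain c where c: "c \<in> C" by (metis card_gt_0_iff ex_in_conv)
  have "\<exists>l. A = {l}"
  proof (rule grp_is_singleton[OF fin(1) _ ex(1)])
    show "A \<subseteq> eigenvalues M" using AB(1) by blast
    show "grp A $ c \<noteq> 0" using C(2) c by blast
    show "grp A $ c $ w \<noteq> 0" if "grp A $ w \<noteq> 0" for w
      using that C(2,4) c nC sym_idem_diag_zero_iff[OF sp.P] by (cases "w = c") auto
  qed
  then obtain l where l: "A = {l}" by blast
  \<comment> \<open>The row of \<open>grp A\<close> at a vanishes, so the row of
    \<open>grp B\<close> there is that of I - J/n, all of whose entries are nonzero. This makes a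
    the vertex required by \<open>grp_is_singleton\<close>.\<close>
  have Baa: "grp B $ a $ a \<noteq> 0"
  proof -
    have "real CARD('n) \<noteq> 1" using C(1) sp.trace_add tr by linarith
    then show ?thesis using sp.diag_add[of a] C(2)[of a] aC by (auto simp: field_simps)
  qed
  have "\<exists>m. B = {m}"
  proof (rule grp_is_singleton[OF fin(2) _ ex(2)])
    show "B \<subseteq> eigenvalues M" using AB(1) by blast
    show "grp B $ a \<noteq> 0" using Baa by auto
    show "grp B $ a $ w \<noteq> 0" for w
      using C(3)[OF aC(1)] Baa by (cases "w = a") auto
  qed
  then obtain m where m: "B = {m}" by blast
  have "l \<noteq> m" using AB(2) l m by auto
  then have M: "M $ u $ w = l * grp A $ u $ w + m * grp B $ u $ w" for u w
    using AB(1) by (subst M_eq_sum_spec) (simp add: l m grp_singleton AB(1)[symmetric])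
  have row: "M $ u $ w = m * (- 1 / real CARD('n))" if "u \<notin> C" "w \<noteq> u" for u w
    using C(2)[of u] C(3)[of u w] that by (auto simp: M)
  have "M $ u $ w = l * (- 1 / real (card C)) + m * (1 / real (card C) - 1 / real CARD('n))"
    if "u \<noteq> w" "u \<notin> {a, b}" "w \<notin> {a, b}" for u w
  proof -
    have "u \<in> C" "w \<in> C" using that ab(1) by auto
    then have "grp A $ u $ w = - 1 / real (card C)" using C(4) that(1) by blast
    moreover from this have "grp B $ u $ w = 1 / real (card C) - 1 / real CARD('n)"
      using sp.splits[of u w] that(1) by simp
    ultimately show ?thesis by (simp only: M)
  qed
  then show ?thesis using row aC ab(2) by blast
qed

text \<open>The deficit is twice the cost plus two nonnegative excesses, which
  \<open>cost_bound\<close> and \<open>extremal_deficit_le_traces\<close> bound below. In the case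
  of equality every one of these estimates is tight, which supplies all assumptions of
  \<open>two_group_shape\<close>.\<close>

lemma deficit_two_groups_ordered:
  assumes AB: "A \<union> B = spec" "A \<inter> B = {}"
    and tr: "2 \<le> trace (grp B)" "trace (grp B) \<le> trace (grp A)"
  shows "extremal_deficit (real CARD('n)) \<le> deficit" (is ?le)
    and "deficit = extremal_deficit (real CARD('n)) \<Longrightarrow>
      \<exists>a b \<theta> \<delta>. a \<noteq> b \<and> (\<forall>w. w \<noteq> a \<longrightarrow> M $ a $ w = \<theta>) \<and> (\<forall>w. w \<noteq> b \<longrightarrow> M $ b $ w = \<theta>) \<and>
      (\<forall>u w. u \<noteq> w \<longrightarrow> u \<notin> {a, b} \<longrightarrow> w \<notin> {a, b} \<longrightarrow> M $ u $ w = \<delta>)" (is "_ \<Longrightarrow> ?shape")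
proof -
  interpret sp: simplex_splitting "grp A" "grp B" by (rule splitting[OF AB])
  have fin: "finite A" "finite B" using AB(1) finite_spec by (metis finite_Un)+
  define k where "k = trace (grp B)"
  define m where "m = trace (grp A)"
  define exA where "exA = (\<Sum>u\<in>UNIV. (grp A $ u $ u)\<^sup>2 - (\<Sum>l\<in>A. (proj l $ u $ u)\<^sup>2))"
  define exB where "exB = (\<Sum>u\<in>UNIV. (grp B $ u $ u)\<^sup>2 - (\<Sum>l\<in>B. (proj l $ u $ u)\<^sup>2))"
  have km: "2 \<le> k" "k \<le> m" "real CARD('n) = k + m + 1"
    using tr sp.trace_add by (simp_all add: k_def m_def)
  have ex: "exA \<ge> 0" "exB \<ge> 0"
    using grp_excess(1) fin by (simp_all add: exA_def exB_def)
  have d: "deficit = 2 * sp.cost + exA + exB"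
    using deficit_split[OF AB] by (simp add: exA_def exB_def)
  have "m * k / real CARD('n) \<le> (m + 1) * sp.cost"
    using sp.cost_bound km unfolding k_def m_def by simp
  then have c: "m * k / real CARD('n) / (m + 1) \<le> sp.cost"
  proof -
    have "m + 1 > 0" using km by simp
    then show ?thesis
      using \<open>m * k / real CARD('n) \<le> (m + 1) * sp.cost\<close> by (simp only: pos_divide_le_eq mult.commute)
  qed
  note e = extremal_deficit_le_traces[OF km]
  show ?le using e(1) c ex d by linarith
  assume eq: "deficit = extremal_deficit (real CARD('n))"
  have ex0: "exA = 0" "exB = 0" and c0: "sp.cost = m * k / real CARD('n) / (m + 1)"
    and "extremal_deficit (real CARD('n)) = 2 * (m * k / real CARD('n) / (m + 1))"
    using e(1) c ex d eq by linarith+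
  then have k2: "k = 2" using e(2) by blast
  have trs: "trace (grp B) = 2" "trace (grp A) > 0" using k2 km by (simp_all add: k_def m_def)
  have "(m + 1) * sp.cost = m * k / real CARD('n)" using c0 km by simp
  then have "(\<forall>u v. grp A $ u $ u \<noteq> 0 \<longrightarrow> grp A $ v $ v \<noteq> 0 \<longrightarrow> grp B $ u = grp B $ v) \<or>
    m = k \<and> (\<forall>u v. grp B $ u $ u \<noteq> 0 \<longrightarrow> grp B $ v $ v \<noteq> 0 \<longrightarrow> grp A $ u = grp A $ v)"
    using km unfolding k_def m_def by (intro sp.cost_bound_eq) auto
  then consider (1) "\<forall>u v. grp A $ u $ u \<noteq> 0 \<longrightarrow> grp A $ v $ v \<noteq> 0 \<longrightarrow> grp B $ u = grp B $ v"
    | (2) "m = k" "\<forall>u v. grp B $ u $ u \<noteq> 0 \<longrightarrow> grp B $ v $ v \<noteq> 0 \<longrightarrow> grp A $ u = grp A $ v"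
    by blast
  then show ?shape
  proof cases
    case 1
    then show ?thesis
      by (rule two_group_shape[OF AB ex0[unfolded exA_def exB_def] trs])
  next
    \<comment> \<open>Both traces are 2 here, so the two groups may exchange roles.\<close>
    case 2
    have "B \<union> A = spec" "B \<inter> A = {}" using AB by auto
    then show ?thesis
      by (rule two_group_shape[OF _ _ ex0(2,1)[unfolded exA_def exB_def] _ _ 2(2)])
        (use 2(1) k2 in \<open>simp_all add: k_def m_def\<close>)
  qed
qed

lemma deficit_two_groups:
  assumes AB: "A \<union> B = spec" "A \<inter> B = {}"
    and tr: "2 \<le> trace (grp A)" "2 \<le> trace (grp B)"
  shows "extremal_deficit (real CARD('n)) \<le> deficit"
    and "deficit = extremal_deficit (real CARD('n)) \<Longrightarrow>
      \<exists>a b \<theta> \<delta>. a \<noteq> b \<and> (\<forall>w. w \<noteq> a \<longrightarrow> M $ a $ w = \<theta>) \<and> (\<forall>w. w \<noteq> b \<longrightarrow> M $ b $ w = \<theta>) \<and>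
      (\<forall>u w. u \<noteq> w \<longrightarrow> u \<notin> {a, b} \<longrightarrow> w \<notin> {a, b} \<longrightarrow> M $ u $ w = \<delta>)"
proof -
  have BA: "B \<union> A = spec" "B \<inter> A = {}" using AB by auto
  show "extremal_deficit (real CARD('n)) \<le> deficit"
    using deficit_two_groups_ordered(1)[OF AB tr(2)] deficit_two_groups_ordered(1)[OF BA tr(1)] by linarith
  assume "deficit = extremal_deficit (real CARD('n))"
  then show "\<exists>a b \<theta> \<delta>. a \<noteq> b \<and> (\<forall>w. w \<noteq> a \<longrightarrow> M $ a $ w = \<theta>) \<and> (\<forall>w. w \<noteq> b \<longrightarrow> M $ b $ w = \<theta>) \<and>
      (\<forall>u w. u \<noteq> w \<longrightarrow> u \<notin> {a, b} \<longrightarrow> w \<notin> {a, b} \<longrightarrow> M $ u $ w = \<delta>)"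
    using deficit_two_groups_ordered(2)[OF AB tr(2)] deficit_two_groups_ordered(2)[OF BA tr(1)]
    by (cases "trace (grp B) \<le> trace (grp A)") simp_all
qed

end


section \<open>Spectra that cannot be grouped\<close>

lemma trace_rank_one:
  fixes P :: "real^'n^'n"
  assumes "norm x = 1" "\<And>u v. P $ u $ v = x $ u * x $ v"
  shows "trace P = 1"
  using assms(1) unfolding trace_def norm_eq_1 inner_vec_def by (simp add: assms(2))

text \<open>
  If \<open>x\<close> has one zero entry then the nonnegative value of the products is \<open>0\<close>, which leaves one
  positive and one negative entry; otherwise all entries of the same sign agree.
\<close>

lemma two_valued_products:
  fixes x :: "real^'n"
  assumes n: "CARD('n) \<ge> 4" and x: "(\<Sum>u\<in>UNIV. x $ u) = 0" "x \<noteq> 0"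
    and two: "\<forall>u v. u \<noteq> v \<longrightarrow> x $ u * x $ v = \<alpha> \<or> x $ u * x $ v = \<beta>"
  shows "(\<exists>a b. a \<noteq> b \<and> x $ a \<noteq> 0 \<and> x $ b = - x $ a \<and> (\<forall>u. u \<noteq> a \<longrightarrow> u \<noteq> b \<longrightarrow> x $ u = 0)) \<or>
    (\<exists>r. \<forall>u. (x $ u)\<^sup>2 = r) \<or>
    (\<exists>c s. x $ c * s < 0 \<and> (\<forall>u. u \<noteq> c \<longrightarrow> x $ u = s))"
proof -
  obtain a where a: "x $ a > 0"
  proof (rule ccontr)
    assume "\<not> thesis"
    then have "\<forall>u. - x $ u \<ge> 0" using that by (meson neg_0_le_iff_le not_less)
    moreover have "(\<Sum>u\<in>UNIV. - x $ u) = 0" using x(1) by (simp add: sum_negf)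
    ultimately have "\<forall>u. - x $ u = 0" by (subst (asm) sum_nonneg_eq_0_iff) auto
    then show False using x(2) by (simp add: vec_eq_iff)
  qed
  obtain b where b: "x $ b < 0"
  proof (rule ccontr)
    assume "\<not> thesis"
    then have "\<forall>u. x $ u \<ge> 0" using that by (meson not_less)
    then have "\<forall>u. x $ u = 0" using x(1) by (subst (asm) sum_nonneg_eq_0_iff) auto
    then show False using x(2) by (simp add: vec_eq_iff)
  qed
  have ab: "a \<noteq> b" using a b by auto
  have "card {a, b} < CARD('n)" using n ab by simp
  then obtain v where v: "v \<notin> {a, b}" by (metis UNIV_eq_I nat_neq_iff)
  define \<mu> where "\<mu> = x $ a * x $ b"
  have \<mu>: "\<mu> < 0" using a b by (simp add: \<mu>_def mult_pos_neg)
  have "\<exists>u w. u \<noteq> w \<and> x $ u * x $ w \<ge> 0"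
  proof (cases "x $ v \<ge> 0")
    case True
    then show ?thesis using a v by (intro exI[of _ a] exI[of _ v]) auto
  next
    case False
    then show ?thesis using b v by (intro exI[of _ b] exI[of _ v]) (auto simp: mult_nonpos_nonpos)
  qed
  then obtain \<nu> where \<nu>: "\<nu> \<ge> 0" "\<And>u w. u \<noteq> w \<Longrightarrow> x $ u * x $ w = \<mu> \<or> x $ u * x $ w = \<nu>"
    using two two[rule_format, OF ab] \<mu> unfolding \<mu>_def by (metis not_less)
  have neg: "x $ u * x $ w = \<mu>" if "x $ u * x $ w < 0" for u w
  proof -
    have "u \<noteq> w" using that by (auto simp: mult_less_0_iff)
    then show ?thesis using \<nu> that by fastforce
  qed
  have nonneg: "x $ u * x $ w = \<nu>" if "u \<noteq> w" "x $ u * x $ w \<ge> 0" for u w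
    using \<nu>(2)[OF that(1)] that(2) \<mu> by auto
  have pos_a: "x $ u = x $ a" if "x $ u > 0" for u
  proof -
    have "x $ u * x $ b = x $ a * x $ b" using neg[of u b] that b \<mu>_def by (simp add: mult_pos_neg)
    then show ?thesis using b by simp
  qed
  have neg_b: "x $ u = x $ b" if "x $ u < 0" for u
  proof -
    have "x $ a * x $ u = x $ a * x $ b" using neg[of a u] that a \<mu>_def by (simp add: mult_pos_neg)
    then show ?thesis using a by simp
  qed
  show ?thesis
  proof (cases "\<exists>z. x $ z = 0")
    case True
    then obtain z where z: "x $ z = 0" by blast
    then have "a \<noteq> z" using a by auto
    then have \<nu>0: "\<nu> = 0" using nonneg[of a z] z by simp
    have rest: "x $ u = 0" if "u \<noteq> a" "u \<noteq> b" for u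
    proof (rule ccontr)
      assume "x $ u \<noteq> 0"
      then consider "x $ u > 0" | "x $ u < 0" by linarith
      then show False
      proof cases
        case 1
        then have "x $ u * x $ a > 0" using a by simp
        then show False using nonneg[of u a] that \<nu>0 by auto
      next
        case 2
        then have "x $ u * x $ b > 0" using b by (simp add: mult_neg_neg)
        then show False using nonneg[of u b] that \<nu>0 by auto
      qed
    qed
    have "(\<Sum>u\<in>UNIV. x $ u) = (\<Sum>u\<in>{a, b}. x $ u)"
      using rest by (intro sum.mono_neutral_right) auto
    then have "x $ b = - x $ a" using x(1) ab by simp
    then show ?thesis using rest ab a by (metis less_irrefl)
  next
    case False
    then have cases: "x $ u = x $ a \<or> x $ u = x $ b" for u
      using pos_a neg_b by (metis linorder_neqE_linordered_idom)
    consider (a) "\<forall>u. u \<noteq> a \<longrightarrow> x $ u = x $ b" | (b) "\<forall>u. u \<noteq> b \<longrightarrow> x $ u = x $ a"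
      | (both) a' b' where "a' \<noteq> a" "x $ a' = x $ a" "b' \<noteq> b" "x $ b' = x $ b"
      using cases by metis
    then show ?thesis
    proof cases
      case a
      have "x $ a * x $ b < 0" using \<mu> by (simp add: \<mu>_def)
      then show ?thesis using a by blast
    next
      case b
      have "x $ b * x $ a < 0" using \<mu> by (simp add: \<mu>_def mult.commute)
      then show ?thesis using b by blast
    next
      case both
      have "(x $ a)\<^sup>2 = \<nu>" "(x $ b)\<^sup>2 = \<nu>"
        using nonneg[OF both(1)] nonneg[OF both(3)] both(2,4) by (simp_all add: power2_eq_square)
      then have "(x $ u)\<^sup>2 = \<nu>" for u using cases[of u] by auto
      then show ?thesis by blast
    qed
  qed
qed

section \<open>Simple spectra, one simple eigenvalue beside another, and the combined bound\<close>

context kernel_constant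
begin

lemma trace_grp: "trace (grp A) = (\<Sum>l\<in>A. trace (proj l))"
  unfolding grp_def by (rule trace_sum)

lemma trace_grp_spec: "trace (grp spec) = real CARD('n) - 1"
  unfolding trace_def grp_spec by (simp add: field_simps)

lemma trace_proj_ge_1: "l \<in> spec \<Longrightarrow> trace (proj l) \<ge> 1"
  using sym_idem_trace_ge_1[OF sym_idem_proj proj_nonzero] by simp

lemma splitting_single: "l \<in> spec \<Longrightarrow> simplex_splitting (grp (spec - {l})) (proj l)"
  using splitting[of "spec - {l}" "{l}"] by (simp add: grp_singleton insert_absorb)

text \<open>Splitting off any of the n - 1 eigenvalues costs at least \<open>t\<close>, and these
  bounds sum to (n - 2)/n. Equality would give every projection a row of I - J/n, but such rows of
  two different projections cannot be orthogonal.\<close>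

lemma deficit_simple_spectrum:
  assumes n: "CARD('n) \<ge> 4" and simple: "\<And>l. l \<in> spec \<Longrightarrow> trace (proj l) = 1"
  shows "deficit > (real CARD('n) - 2) / real CARD('n)"
proof -
  let ?n = "real CARD('n)"
  define cost where "cost l = simplex_splitting.cost (grp (spec - {l})) (proj l)" for l
  define t where "t = (?n - 2) / ?n / (?n - 1)"
  have n4: "?n \<ge> 4" using n by simp
  have card: "real (card spec) = ?n - 1"
    using trace_grp_spec trace_grp[of spec] simple by simp
  have tr: "trace (grp (spec - {l})) = ?n - 2" if "l \<in> spec" for l
    using simplex_splitting.trace_add[OF splitting_single[OF that]] simple[OF that] by simp
  have cost_ge: "cost l \<ge> t" if l: "l \<in> spec" for l
  proof -
    interpret sp: simplex_splitting "grp (spec - {l})" "proj l" by (rule splitting_single[OF l])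
    have "(?n - 2) / ?n \<le> (?n - 1) * cost l"
      using sp.cost_bound tr[OF l] simple[OF l] n4 by (simp add: cost_def)
    then show ?thesis using n4 by (simp only: t_def pos_divide_le_eq mult.commute)
  qed
  have tn: "(\<Sum>l\<in>spec. t) = (?n - 2) / ?n" using n4 by (simp add: card t_def)
  have d: "deficit = (\<Sum>l\<in>spec. cost l)" by (simp add: deficit_eq_sum_cost cost_def)
  show ?thesis
  proof (rule ccontr)
    assume "\<not> ?thesis"
    then have "(\<Sum>l\<in>spec. cost l - t) \<le> 0" using d tn by (simp add: sum_subtractf)
    then have "(\<Sum>l\<in>spec. cost l - t) = 0"
      using cost_ge by (intro antisym sum_nonneg) auto
    then have "\<forall>l\<in>spec. cost l - t = 0"
      using sum_nonneg_eq_0_iff[OF finite_spec, of "\<lambda>l. cost l - t"] cost_ge by simp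
    then have cost_eq: "cost l = t" if "l \<in> spec" for l using that by simp
    have ex: "\<exists>u. \<forall>w. proj l $ u $ w = (if u = w then 1 else 0) - 1 / ?n" if l: "l \<in> spec" for l
    proof -
      interpret sp: simplex_splitting "grp (spec - {l})" "proj l" by (rule splitting_single[OF l])
      have "(trace (grp (spec - {l})) + 1) * sp.cost
          = trace (grp (spec - {l})) * trace (proj l) / ?n"
        using cost_eq[OF l] tr[OF l] simple[OF l] n4 by (simp add: cost_def t_def)
      then have "(\<forall>u v. grp (spec - {l}) $ u $ u \<noteq> 0 \<longrightarrow> grp (spec - {l}) $ v $ v \<noteq> 0
            \<longrightarrow> proj l $ u = proj l $ v) \<or>
          trace (grp (spec - {l})) = trace (proj l) \<and>
          (\<forall>u v. proj l $ u $ u \<noteq> 0 \<longrightarrow> proj l $ v $ v \<noteq> 0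
            \<longrightarrow> grp (spec - {l}) $ u = grp (spec - {l}) $ v)"
        by (intro sp.cost_bound_eq) (use tr[OF l] simple[OF l] n4 in simp_all)
      moreover have "trace (grp (spec - {l})) \<noteq> trace (proj l)"
        using tr[OF l] simple[OF l] n4 by simp
      ultimately have "\<forall>u v. grp (spec - {l}) $ u $ u \<noteq> 0 \<longrightarrow> grp (spec - {l}) $ v $ v \<noteq> 0
          \<longrightarrow> proj l $ u = proj l $ v"
        by blast
      from sp.constant_rows[OF _ this] obtain C where
        C: "real (card C) = trace (grp (spec - {l})) + 1" "\<forall>u. grp (spec - {l}) $ u \<noteq> 0 \<longleftrightarrow> u \<in> C"
        using tr[OF l] n4 by auto
      \<comment> \<open>The trace n - 2 makes \<open>C\<close> miss one vertex. There the
        complementary projection has a zero row, which leaves the row of I - J/n to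
        \<open>proj l\<close>.\<close>
      have "card C \<noteq> CARD('n)" using C(1) tr[OF l] by auto
      then obtain u where "u \<notin> C" by (metis UNIV_eq_I)
      then have "grp (spec - {l}) $ u = 0" using C(2) by blast
      then have "proj l $ u $ w = (if u = w then 1 else 0) - 1 / ?n" for w
        using sp.splits[of u w] by simp
      then show ?thesis by blast
    qed
    have "card spec \<ge> 2" using card n4 by linarith
    then obtain l m where lm: "l \<in> spec" "m \<in> spec" "l \<noteq> m"
      by (metis card_le_Suc0_iff_eq finite_spec not_less_eq_eq numeral_2_eq_2)
    obtain u where u: "\<And>w. proj l $ u $ w = (if u = w then 1 else 0) - 1 / ?n"
      using ex[OF lm(1)] by blast
    obtain v where v: "\<And>w. proj m $ v $ w = (if v = w then 1 else 0) - 1 / ?n"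
      using ex[OF lm(2)] by blast
    have row: "(\<Sum>w\<in>UNIV. proj m $ v $ w) = 0"
      using simplex_splitting.sum_row[OF simplex_splitting.swapped[OF splitting_single[OF lm(2)]]] .
    \<comment> \<open>Since the rows of \<open>proj m\<close> sum to 0, pairing one with a row of I
      - J/n only reads off an entry, and that entry is -1/n or 1 - 1/n.\<close>
    have "0 = proj l $ u \<bullet> proj m $ v"
      using proj_mult_proj[OF lm(3)] sym_idem_proj[of m] matrix_mult_symmetric_entry[of "proj m" "proj l" u v]
      by (simp add: sym_idem_def)
    also have "\<dots> = (\<Sum>w\<in>UNIV. (if u = w then proj m $ v $ w else 0) - 1 / ?n * proj m $ v $ w)"
      unfolding inner_vec_def u by (intro sum.cong) (auto simp: algebra_simps)
    also have "\<dots> = proj m $ v $ u"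
      by (simp only: sum_subtractf sum_distrib_left[symmetric] row) simp
    finally show False using v[of u] n4 by (auto split: if_splits)
  qed
qed

text \<open>Off the diagonal, \<open>M\<close> is an affine function of the products of coordinates
  of x, so entries 0 and -1 allow only two products and \<open>two_valued_products\<close> applies.
  The deficit depends on x only through the sum of its fourth powers.\<close>

lemma deficit_rank_one:
  assumes n: "CARD('n) \<ge> 4" and spec: "spec = {l, m}" "l \<noteq> m"
    and x: "norm x = 1" "\<And>u v. proj m $ u $ v = x $ u * x $ v"
    and entries: "\<forall>u v. u \<noteq> v \<longrightarrow> M $ u $ v = 0 \<or> M $ u $ v = -1"
  shows "(real CARD('n) - 2) / real CARD('n) \<le> deficit \<and>
      (deficit = (real CARD('n) - 2) / real CARD('n) \<longrightarrow>
        (\<exists>a b \<eta>. a \<noteq> b \<and> M $ a $ b \<noteq> \<eta> \<and>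
          (\<forall>u w. u \<noteq> w \<longrightarrow> (u, w) \<noteq> (a, b) \<longrightarrow> (u, w) \<noteq> (b, a) \<longrightarrow> M $ u $ w = \<eta>))) \<or>
    (\<exists>c \<alpha> \<beta>. \<alpha> \<noteq> \<beta> \<and> (\<forall>w. w \<noteq> c \<longrightarrow> M $ c $ w = \<alpha>) \<and>
      (\<forall>u w. u \<noteq> w \<longrightarrow> u \<noteq> c \<longrightarrow> w \<noteq> c \<longrightarrow> M $ u $ w = \<beta>))"
proof -
  let ?n = "real CARD('n)"
  note off = entries[rule_format]
  have AB: "{l} \<union> {m} = spec" "{l} \<inter> {m} = {}" using spec by auto
  interpret sp: simplex_splitting "grp {l}" "grp {m}" by (rule splitting[OF AB])
  have n4: "?n \<ge> 4" using n by simp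
  have gm: "grp {m} $ u $ v = x $ u * x $ v" for u v by (simp add: grp_singleton x(2))
  have gl: "grp {l} $ u $ v = (if u = v then 1 else 0) - 1 / ?n - x $ u * x $ v" for u v
    using sp.splits[of u v] by (simp add: gm)
  have M: "M $ u $ v = - l / ?n + (m - l) * (x $ u * x $ v)" if "u \<noteq> v" for u v
  proof -
    have "M $ u $ v = l * grp {l} $ u $ v + m * grp {m} $ u $ v"
      by (subst M_eq_sum_spec) (simp add: spec grp_singleton)
    then show ?thesis using that by (simp add: gl gm algebra_simps)
  qed
  have prod_eq: "x $ u * x $ v = (M $ u $ v + l / ?n) / (m - l)" if "u \<noteq> v" for u v
    using M[OF that] spec(2) by simp
  have x2: "(\<Sum>u\<in>UNIV. (x $ u)\<^sup>2) = 1"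
    using x(1) unfolding norm_eq_1 inner_vec_def by (simp add: power2_eq_square)
  have x0: "x \<noteq> 0" using x(1) by auto
  then obtain v where v: "x $ v \<noteq> 0" by (auto simp: vec_eq_iff)
  have "x $ v * (\<Sum>u\<in>UNIV. x $ u) = 0"
    using simplex_splitting.sum_row[OF sp.swapped, of v] by (simp add: gm sum_distrib_left)
  then have xs: "(\<Sum>u\<in>UNIV. x $ u) = 0" using v by simp
  have d: "deficit = 2 * (1 - 1 / ?n) - 2 * (\<Sum>u\<in>UNIV. (x $ u)^4)"
  proof -
    have "deficit = 2 * sp.cost"
      using deficit_split[OF AB] by (simp add: grp_singleton)
    also have "sp.cost = (\<Sum>u\<in>UNIV. (1 - 1 / ?n - (x $ u)\<^sup>2) * (x $ u)\<^sup>2)"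
      unfolding sp.cost_def gl gm by (simp add: power2_eq_square)
    also have "(\<Sum>u\<in>UNIV. (1 - 1 / ?n - (x $ u)\<^sup>2) * (x $ u)\<^sup>2)
        = (1 - 1 / ?n) * (\<Sum>u\<in>UNIV. (x $ u)\<^sup>2) - (\<Sum>u\<in>UNIV. (x $ u)^4)"
      by (simp only: left_diff_distrib sum_subtractf sum_distrib_left power2_eq_square
          power4_eq_xxxx mult.assoc)
    finally show ?thesis by (simp add: x2)
  qed
  have "\<forall>u v. u \<noteq> v \<longrightarrow> x $ u * x $ v = (0 + l / ?n) / (m - l) \<or> x $ u * x $ v = (-1 + l / ?n) / (m - l)"
    using off prod_eq by metis
  from two_valued_products[OF n xs x0 this]
  show ?thesis
  proof (elim disjE exE conjE)
    \<comment> \<open>Here x is a multiple of the difference of two coordinate vectors, with fourth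
      powers summing to 1/2, and \<open>M\<close> has a single exceptional off-diagonal
      pair.\<close>
    fix a b assume edge: "a \<noteq> b" "x $ a \<noteq> 0" "x $ b = - x $ a" "\<forall>u. u \<noteq> a \<longrightarrow> u \<noteq> b \<longrightarrow> x $ u = 0"
    have "1 = (\<Sum>u\<in>{a, b}. (x $ u)\<^sup>2)"
      unfolding x2[symmetric] using edge(4) by (intro sum.mono_neutral_right) auto
    then have xa: "(x $ a)\<^sup>2 = 1 / 2" using edge(1,3) by simp
    have "(\<Sum>u\<in>UNIV. (x $ u)^4) = (\<Sum>u\<in>{a, b}. (x $ u)^4)"
      using edge(4) by (intro sum.mono_neutral_right) auto
    also have "\<dots> = 2 * ((x $ a)\<^sup>2)\<^sup>2" using edge(1,3) by simp
    also have "\<dots> = 1 / 2" unfolding xa by (simp add: power2_eq_square)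
    finally have "deficit = (?n - 2) / ?n" using n4 by (simp add: d field_simps)
    moreover have "M $ a $ b \<noteq> - l / ?n"
      using M[OF edge(1)] spec(2) edge(2,3) by simp
    moreover have "M $ u $ w = - l / ?n" if "u \<noteq> w" "(u, w) \<noteq> (a, b)" "(u, w) \<noteq> (b, a)" for u w
    proof -
      have "x $ u = 0 \<or> x $ w = 0"
      proof (rule ccontr)
        assume "\<not> ?thesis"
        then have "u = a \<or> u = b" "w = a \<or> w = b" using edge(4) by auto
        then show False using that by auto
      qed
      then show ?thesis using M[OF that(1)] by auto
    qed
    ultimately show ?thesis
      using edge(1)
      by (intro disjI1 conjI impI exI[of _ a] exI[of _ b] exI[of _ "- l / ?n"]) simp_all
  next
    fix r assume flat: "\<forall>u. (x $ u)\<^sup>2 = r"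
    have r: "r = 1 / ?n" using x2 n4 by (simp add: flat field_simps)
    have "(x $ u)^4 = r\<^sup>2" for u unfolding flat[rule_format, of u, symmetric] by simp
    then have "deficit = 2 * (1 - 1 / ?n) - 2 * (?n * (1 / ?n)\<^sup>2)" by (simp add: d r)
    also have "\<dots> = 2 * (?n - 2) / ?n" using n4 by (simp add: field_simps power2_eq_square)
    also have "\<dots> > (?n - 2) / ?n" using n4 by (simp add: field_simps)
    finally show ?thesis by simp
  next
    \<comment> \<open>In this case only the shape of \<open>M\<close> is recorded;
      \<open>deficit_bound\<close> recognizes it as that of a star.\<close>
    fix c s assume star: "x $ c * s < 0" "\<forall>u. u \<noteq> c \<longrightarrow> x $ u = s"
    have "M $ c $ w = - l / ?n + (m - l) * (x $ c * s)" if "w \<noteq> c" for w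
      using M[of c w] that star(2) by simp
    moreover have "M $ u $ w = - l / ?n + (m - l) * (s * s)" if "u \<noteq> w" "u \<noteq> c" "w \<noteq> c" for u w
      using M[OF that(1)] star(2) that by simp
    moreover have "- l / ?n + (m - l) * (x $ c * s) \<noteq> - l / ?n + (m - l) * (s * s)"
      using star(1) spec(2) by (auto simp: mult_less_0_iff)
    ultimately show ?thesis
      by (intro disjI2 exI[of _ c] exI[of _ "- l / ?n + (m - l) * (x $ c * s)"]
          exI[of _ "- l / ?n + (m - l) * (s * s)"]) simp
  qed
qed

text \<open>This is the absence of isolated vertices. Rows of \<open>M\<close> sum to 0, so a row
  vanishing off the diagonal vanishes altogether; the coordinate vector at u would then be in the
  kernel, although it is not constant.\<close>

lemma nonzero_in_row:
  assumes n: "CARD('n) \<ge> 2"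
  shows "\<exists>w. w \<noteq> u \<and> M $ u $ w \<noteq> 0"
proof (rule ccontr)
  assume "\<not> ?thesis"
  then have row: "M $ u $ w = 0" if "w \<noteq> u" for w using that by blast
  have one: "proj 0 *v 1 = 1"
    by (simp add: vec_eq_iff matrix_vector_mult_def proj_0)
  then have "M *v 1 = 0" using proj_in[of 0 1] by simp
  then have "(\<Sum>w\<in>UNIV. M $ u $ w) = 0" by (simp add: vec_eq_iff matrix_vector_mult_def)
  then have "M $ u $ u = 0"
    using row by (simp add: sum.remove[of UNIV u])
  then have "M $ u $ w = 0" for w using row by (cases "w = u") auto
  then have "M $ w $ u = 0" for w using symmetric_entry[OF symm] by metis
  then have "M *v axis u 1 = 0 *\<^sub>R axis u 1"
    by (simp add: vec_eq_iff matrix_vector_mult_def axis_def if_distrib cong: if_cong)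
  then have "proj 0 *v axis u 1 = axis u 1" by (rule proj_fix)
  moreover obtain w where w: "w \<noteq> u"
  proof -
    have "(UNIV :: 'n set) \<noteq> {u}" using n by (metis card_1_singleton_iff One_nat_def Suc_n_not_le_n numeral_2_eq_2)
    then show ?thesis using that by blast
  qed
  ultimately have "(proj 0 *v axis u 1) $ w = 0" by (simp add: axis_def)
  then show False
    by (simp add: matrix_vector_mult_def axis_def proj_0 if_distrib cong: if_cong)
qed

lemma deficit_bound:
  assumes n: "CARD('n) \<ge> 4"
    and entries: "\<forall>u v. u \<noteq> v \<longrightarrow> M $ u $ v = 0 \<or> M $ u $ v = -1"
    and not_complete: "\<exists>u v. u \<noteq> v \<and> M $ u $ v = 0"
    and not_star: "\<nexists>c. \<forall>u v. u \<noteq> v \<longrightarrow> M $ u $ v = (if u = c \<or> v = c then -1 else 0)"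
  shows "extremal_deficit (real CARD('n)) \<le> deficit"
    and "deficit = extremal_deficit (real CARD('n)) \<Longrightarrow>
      \<exists>a b. a \<noteq> b \<and> (\<forall>u v. u \<noteq> v \<longrightarrow> M $ u $ v = (if u \<in> {a, b} \<or> v \<in> {a, b} then -1 else 0))"
      (is "_ \<Longrightarrow> ?extremal")
proof -
  let ?n = "real CARD('n)"
  note off = entries[rule_format]
  have n4: "?n \<ge> 4" using n by simp
  have sym: "M $ u $ v = M $ v $ u" for u v by (rule symmetric_entry[OF symm])
  have row: "\<exists>w. w \<noteq> u \<and> M $ u $ w = -1" for u
  proof -
    obtain w where "w \<noteq> u" "M $ u $ w \<noteq> 0" using nonzero_in_row[of u] n by auto
    then show ?thesis using off[of u w] by auto
  qed
  have "extremal_deficit ?n \<le> deficit \<and> (deficit = extremal_deficit ?n \<longrightarrow> ?extremal)"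
  proof (cases "\<forall>l\<in>spec. trace (proj l) = 1")
    case True
    then show ?thesis
      using deficit_simple_spectrum[OF n] extremal_deficit_le(1)[OF n4] by fastforce
  next
    case False
    then obtain l where l: "l \<in> spec" "trace (proj l) \<noteq> 1" by blast
    have tl: "trace (proj l) \<ge> 2"
      using sym_idem_rank_one_or_trace_ge_2[OF sym_idem_proj proj_nonzero] trace_rank_one l by blast
    let ?R = "spec - {l}"
    have AB: "{l} \<union> ?R = spec" "{l} \<inter> ?R = {}" using l(1) by auto
    \<comment> \<open>The eigenvalue l is multiple. Either the rest has trace at least 2, and two
      groups are available, or the rest is one simple eigenvalue.\<close>
    consider (two) "trace (grp ?R) \<ge> 2" | (one) "trace (grp ?R) < 2" by linarith
    then show ?thesis
    proof cases
      case two
      note two_groups = deficit_two_groups[OF AB, unfolded grp_singleton, OF tl two]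
      have ?extremal if eq: "deficit = extremal_deficit ?n"
      proof -
        obtain a b \<theta> \<delta> where ab: "a \<noteq> b" "\<And>w. w \<noteq> a \<Longrightarrow> M $ a $ w = \<theta>" "\<And>w. w \<noteq> b \<Longrightarrow> M $ b $ w = \<theta>"
          "\<And>u w. u \<noteq> w \<Longrightarrow> u \<notin> {a, b} \<Longrightarrow> w \<notin> {a, b} \<Longrightarrow> M $ u $ w = \<delta>"
          using two_groups(2)[OF eq] by blast
        have \<theta>: "\<theta> = -1" using row[of a] ab(2) by auto
        have hit: "M $ u $ w = -1" if "u \<noteq> w" "u \<in> {a, b} \<or> w \<in> {a, b}" for u w
          using that ab(2,3) sym \<theta> by (metis insertE singletonD)
        obtain u v where uv: "u \<noteq> v" "M $ u $ v = 0" using not_complete by blast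
        then have "\<not> (u \<in> {a, b} \<or> v \<in> {a, b})" using hit by fastforce
        then have "\<delta> = 0" using ab(4)[of u v] uv by simp
        then show ?thesis using ab(1,4) hit by (intro exI[of _ a] exI[of _ b]) auto
      qed
      then show ?thesis using two_groups(1) by blast
    next
      case one
      have finR: "finite ?R" using finite_spec by simp
      have "real (card ?R) \<le> trace (grp ?R)"
        unfolding trace_grp using sum_mono[of ?R "\<lambda>_. 1" "\<lambda>l. trace (proj l)"] trace_proj_ge_1 by simp
      then have "card ?R \<le> 1" using one by simp
      \<comment> \<open>With l as the only nonzero eigenvalue, \<open>M\<close> would be l times I -
        J/n, with no zero off the diagonal.\<close>
      moreover have "?R \<noteq> {}"
      proof
        assume "?R = {}"
        then have spec: "spec = {l}" using l(1) by blast
        obtain u v where uv: "u \<noteq> v" "M $ u $ v = 0" using not_complete by blast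
        have "M $ u $ v = l * proj l $ u $ v" by (subst M_eq_sum_spec) (simp add: spec)
        also have "\<dots> = - l / ?n" using grp_spec[of u v] uv(1) by (simp add: spec grp_singleton)
        finally show False using uv(2) l(1) by simp
      qed
      ultimately have "card ?R = 1" using finR by (metis One_nat_def Suc_leI card_gt_0_iff le_antisym)
      then obtain m where m: "?R = {m}" by (metis card_1_singletonE)
      then have spec: "spec = {l, m}" "l \<noteq> m" using l(1) by auto
      then have mspec: "m \<in> spec" by simp
      have "trace (proj m) < 2" using one m by (simp add: grp_singleton)
      then obtain x where x: "norm x = 1" "\<And>u v. proj m $ u $ v = x $ u * x $ v"
        using sym_idem_rank_one_or_trace_ge_2[OF sym_idem_proj proj_nonzero] mspec
        by (metis DiffD1 not_less)
      have third: "\<exists>c. c \<notin> S" if "card S \<le> 3" for S :: "'n set"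
      proof -
        have "S \<noteq> UNIV" using that n by auto
        then show ?thesis by blast
      qed
      from deficit_rank_one[OF n spec x entries] show ?thesis
      proof (elim disjE exE conjE)
        assume edge: "(?n - 2) / ?n \<le> deficit"
          "deficit = (?n - 2) / ?n \<longrightarrow>
            (\<exists>a b \<eta>. a \<noteq> b \<and> M $ a $ b \<noteq> \<eta> \<and>
              (\<forall>u w. u \<noteq> w \<longrightarrow> (u, w) \<noteq> (a, b) \<longrightarrow> (u, w) \<noteq> (b, a) \<longrightarrow> M $ u $ w = \<eta>))"
        have ?extremal if eq: "deficit = extremal_deficit ?n"
        proof -
          \<comment> \<open>Equality forces n = 4. Then the exceptional pair is the missing edge of
            a complete graph on four vertices, and the other two vertices form the required
            pair.\<close>
          have "extremal_deficit ?n = (?n - 2) / ?n"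
            using eq edge(1) extremal_deficit_le(1)[OF n4] by simp
          then have "CARD('n) = 4" using extremal_deficit_le(2)[OF n4] by simp
          obtain a b \<eta> where ab: "a \<noteq> b" "M $ a $ b \<noteq> \<eta>"
            "\<And>u w. u \<noteq> w \<Longrightarrow> (u, w) \<noteq> (a, b) \<Longrightarrow> (u, w) \<noteq> (b, a) \<Longrightarrow> M $ u $ w = \<eta>"
            using edge(2) eq \<open>extremal_deficit ?n = (?n - 2) / ?n\<close> by auto
          have "card (- {a, b}) = 2"
            using \<open>CARD('n) = 4\<close> ab(1) by (simp add: Compl_eq_Diff_UNIV card_Diff_subset)
          then obtain c d where cd: "- {a, b} = {c, d}" "c \<noteq> d" by (auto simp: card_2_iff)
          have "c \<notin> {a, b}" using cd by auto
          then have \<eta>: "\<eta> = -1" using row[of c] ab(3)[of c] by auto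
          have "M $ a $ b = 0" using off[OF ab(1)] ab(2) \<eta> by auto
          then have "M $ u $ v = (if u \<in> {c, d} \<or> v \<in> {c, d} then -1 else 0)" if "u \<noteq> v" for u v
            using ab(3)[OF that] \<eta> sym[of a b] that unfolding cd(1)[symmetric] by auto
          then show ?thesis using cd(2) by blast
        qed
        then show ?thesis using edge(1) extremal_deficit_le(1)[OF n4] by auto
      next
        fix c \<alpha> \<beta> assume star: "\<alpha> \<noteq> \<beta>" "\<forall>w. w \<noteq> c \<longrightarrow> M $ c $ w = \<alpha>"
          "\<forall>u w. u \<noteq> w \<longrightarrow> u \<noteq> c \<longrightarrow> w \<noteq> c \<longrightarrow> M $ u $ w = \<beta>"
        have \<alpha>: "\<alpha> = -1" using row[of c] star(2) by auto
        obtain u where u: "u \<notin> {c}" using third[of "{c}"] by auto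
        have "card {c, u} \<le> 3" by (simp add: card_insert_if)
        then obtain v where v: "v \<notin> {c, u}" using third by blast
        have \<beta>: "\<beta> = 0" using star(1) star(3)[rule_format, of u v] off[of u v] u v \<alpha> by auto
        have "\<forall>u v. u \<noteq> v \<longrightarrow> M $ u $ v = (if u = c \<or> v = c then -1 else 0)"
        proof (intro allI impI)
          fix u v :: 'n assume "u \<noteq> v"
          then show "M $ u $ v = (if u = c \<or> v = c then -1 else 0)"
            using star(2,3) \<alpha> \<beta> sym[of u v] by (cases "u = c"; cases "v = c") auto
        qed
        then have "\<exists>c. \<forall>u v. u \<noteq> v \<longrightarrow> M $ u $ v = (if u = c \<or> v = c then -1 else 0)"
          by (rule exI[of _ c])
        with not_star show ?thesis by (rule notE)
      qed
    qed
  qed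
  then show "extremal_deficit ?n \<le> deficit" "deficit = extremal_deficit ?n \<Longrightarrow> ?extremal"
    by blast+
qed

end


section \<open>The spectrum of the extremal graph\<close>

context symmetric_matrix
begin

text \<open>An eigenvector for \<mu> is killed by each \<open>R m\<close> with m different from
  \<mu>, by orthogonality of eigenvectors. As the \<open>R l\<close> sum to the identity, \<mu> lies
  in \<open>S\<close> and \<open>R\<close> at \<mu> fixes the eigenvector.\<close>

lemma spectrum_eqI:
  assumes S: "finite S" and sum: "(\<Sum>l\<in>S. R l) = mat 1"
    and R: "\<And>l. l \<in> S \<Longrightarrow> sym_idem (R l)" "\<And>l. l \<in> S \<Longrightarrow> R l \<noteq> 0"
    and MR: "\<And>l. l \<in> S \<Longrightarrow> M ** R l = l *\<^sub>R R l"
  shows "eigenvalues M = S" and "\<And>l. l \<in> S \<Longrightarrow> proj l = R l"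
proof -
  have MRv: "M *v (R l *v x) = l *\<^sub>R (R l *v x)" if "l \<in> S" for l x
    by (simp add: matrix_vector_mul_assoc MR that scaleR_matrix_vector_assoc)
  have other: "R m *v x = 0" if "M *v x = \<mu> *\<^sub>R x" "m \<in> S" "m \<noteq> \<mu>" for m \<mu> x
  proof -
    have "(R m *v x) \<bullet> (R m *v x) = (R m *v (R m *v x)) \<bullet> x"
      using R(1)[OF that(2)] by (simp add: symmetric_inner sym_idem_def)
    also have "R m *v (R m *v x) = R m *v x"
      using R(1)[OF that(2)] by (simp add: matrix_vector_mul_assoc sym_idem_def)
    also have "(R m *v x) \<bullet> x = 0"
      using MRv[OF that(2)] that(1,3) by (rule eigenvectors_orthogonal)
    finally show ?thesis by simp
  qed
  have dec: "x = (\<Sum>l\<in>S. R l *v x)" for x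
    using sum_matrix_mult_vec[of R S x] by (simp add: sum)
  have fix_R: "R \<mu> *v x = x" if "M *v x = \<mu> *\<^sub>R x" "\<mu> \<in> S" for \<mu> x
    using dec[of x] other[OF that(1)] S that(2) by (simp add: sum.remove[of S \<mu>])
  show "eigenvalues M = S"
  proof
    show "eigenvalues M \<subseteq> S"
    proof
      fix \<mu> assume "\<mu> \<in> eigenvalues M"
      then obtain x where x: "x \<noteq> 0" "M *v x = \<mu> *\<^sub>R x" by (auto simp: eigenvalues_def)
      show "\<mu> \<in> S"
      proof (rule ccontr)
        assume "\<mu> \<notin> S"
        then have "(\<Sum>l\<in>S. R l *v x) = 0" using other[OF x(2)] by (intro sum.neutral) auto
        then show False using dec[of x] x(1) by simp
      qed
    qed
    show "S \<subseteq> eigenvalues M"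
    proof
      fix l assume l: "l \<in> S"
      then obtain y where "R l *v y \<noteq> 0"
        using R(2) by (metis matrix_eq matrix_vector_mult_0)
      then show "l \<in> eigenvalues M" using MRv[OF l] by (auto simp: eigenvalues_def)
    qed
  qed
  fix l assume l: "l \<in> S"
  have "is_orth_proj (eigenspace M l) (R l)"
    unfolding is_orth_proj_def
  proof (intro allI conjI ballI)
    fix x y
    show "R l *v x \<in> eigenspace M l" using MRv[OF l] by (simp add: eigenspace_def)
    assume "y \<in> eigenspace M l"
    then have "R l *v y = y" using fix_R l by (simp add: eigenspace_def)
    then show "orthogonal (x - R l *v x) y"
      using R(1)[OF l] by (simp add: orthogonal_def inner_diff_left symmetric_inner sym_idem_def)
  qed
  then show "proj l = R l"
    using is_orth_proj_unique[OF subspace_eigenspace] is_orth_proj_orth_proj[OF subspace_eigenspace]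
    by blast
qed

end

section \<open>Explicit projections for the extremal graph\<close>

lemma matrix_mult_diff_left: "(A - B) ** C = A ** C - B ** (C :: real^'n^'n)"
  by (simp add: matrix_matrix_mult_def vec_eq_iff left_diff_distrib sum_subtractf)

lemma matrix_mult_diff_right: "A ** (B - C) = A ** B - A ** (C :: real^'n^'n)"
  by (simp add: matrix_matrix_mult_def vec_eq_iff right_diff_distrib sum_subtractf)

lemma sym_idem_diff:
  assumes "sym_idem E" "sym_idem F" "F ** E = E"
  shows "sym_idem (F - E)" "(F - E) ** E = 0" "E ** (F - E) = 0"
proof -
  have "E ** F = transpose (F ** E)" using assms(1,2) by (simp add: matrix_transpose_mul sym_idem_def)
  also have "\<dots> = E" using assms(1,3) by (simp add: sym_idem_def)
  finally have EF: "E ** F = E" .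
  have "transpose (F - E) = transpose F - transpose E" by (simp add: transpose_def vec_eq_iff)
  then show "sym_idem (F - E)" "(F - E) ** E = 0" "E ** (F - E) = 0"
    using assms EF by (simp_all add: sym_idem_def matrix_mult_diff_left matrix_mult_diff_right)
qed

text \<open>For nonempty \<open>B\<close> this is the orthogonal projection onto the line spanned by
  the indicator vector of \<open>B\<close>; \<open>restriction\<close> projects onto the vectors
  supported on \<open>B\<close>.\<close>

definition averaging :: "'n set \<Rightarrow> real^'n^'n" where
  "averaging B = (\<chi> u v. indicator B u * indicator B v / real (card B))"

definition restriction :: "'n set \<Rightarrow> real^'n^'n" where
  "restriction B = (\<chi> u v. if u = v then indicator B u else 0)"

lemma sym_idem_averaging:
  fixes B :: "'n::finite set"
  assumes "B \<noteq> {}" shows "sym_idem (averaging B)"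
proof -
  have "(\<Sum>w\<in>UNIV. indicator B w * indicator B w) = (\<Sum>w\<in>UNIV. if w \<in> B then 1 else (0 :: real))"
    by (intro sum.cong) (auto simp: indicator_def)
  then have "(\<Sum>w\<in>UNIV. indicator B w * indicator B w) = real (card B)"
    by (simp add: sum.If_cases)
  moreover have "real (card B) \<noteq> 0" using assms by simp
  moreover have "(\<Sum>w\<in>UNIV. indicator B u * indicator B w / real (card B) *
      (indicator B w * indicator B v / real (card B)))
    = indicator B u * indicator B v / (real (card B))\<^sup>2 * (\<Sum>w\<in>UNIV. indicator B w * indicator B w :: real)" for u v
    unfolding sum_distrib_left by (intro sum.cong) (auto simp: power2_eq_square)
  ultimately have "averaging B ** averaging B = averaging B"
    by (simp add: averaging_def matrix_matrix_mult_def vec_eq_iff power2_eq_square)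
  then show ?thesis
    by (simp add: sym_idem_def) (simp add: averaging_def transpose_def vec_eq_iff mult.commute)
qed

lemma restriction_mult: "(restriction B ** A) $ u $ v = indicator B u * A $ u $ v"
  by (simp add: restriction_def matrix_matrix_mult_def if_distrib[where f = "\<lambda>x. x * _"] cong: if_cong)

lemma sym_idem_restriction: "sym_idem (restriction B)"
  unfolding sym_idem_def
proof
  show "transpose (restriction B) = restriction B"
    by (auto simp: restriction_def transpose_def vec_eq_iff)
  show "restriction B ** restriction B = restriction B"
    unfolding vec_eq_iff restriction_mult by (simp add: restriction_def indicator_def)
qed

lemma restriction_averaging: "restriction B ** averaging B = averaging B"
  unfolding vec_eq_iff restriction_mult by (simp add: averaging_def indicator_def)

text \<open>Row sums together with the off-diagonal entries determine the diagonal, so Laplacians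
  can be compared off the diagonal only.\<close>

lemma matrix_eqI_row_sums:
  fixes M N :: "real^'n^'n"
  assumes "\<And>u v. u \<noteq> v \<Longrightarrow> M $ u $ v = N $ u $ v" "M *v 1 = N *v 1"
  shows "M = N"
proof -
  have "M $ u $ u = N $ u $ u" for u
  proof -
    have "(\<Sum>v\<in>UNIV. M $ u $ v) = (\<Sum>v\<in>UNIV. N $ u $ v)"
      using assms(2) by (simp add: vec_eq_iff matrix_vector_mult_def)
    moreover have "(\<Sum>v\<in>UNIV - {u}. M $ u $ v) = (\<Sum>v\<in>UNIV - {u}. N $ u $ v)"
      using assms(1) by (intro sum.cong) auto
    ultimately show ?thesis by (simp add: sum.remove[of UNIV u])
  qed
  then have "M $ u $ v = N $ u $ v" for u v using assms(1) by (cases "u = v") auto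
  then show ?thesis by (simp add: vec_eq_iff)
qed

text \<open>The eigenvalues are 0, 2 and n. \<open>J\<close> belongs to the constants,
  \<open>P\<close> to the vectors supported on \<open>B\<close> with sum 0, and \<open>Q\<close> to
  the remaining two dimensions. The deficit is then twice the cost of a single splitting.\<close>

lemma extremal_spectrum:
  fixes M :: "real^'n^'n"
  assumes n: "CARD('n) \<ge> 4" and sym: "transpose M = M" and one: "M *v 1 = 0" and ab: "a \<noteq> b"
    and entries: "\<forall>u v. u \<noteq> v \<longrightarrow> M $ u $ v = (if u \<in> {a, b} \<or> v \<in> {a, b} then -1 else 0)"
  shows "kernel_constant M" "kernel_constant.deficit M = extremal_deficit (real CARD('n))"
proof -
  let ?n = "real CARD('n)"
  interpret symmetric_matrix M by unfold_locales (rule sym)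
  define B where "B = - {a, b}"
  have n4: "?n \<ge> 4" using n by simp
  have cB: "real (card B) = ?n - 2"
    using ab n by (simp add: B_def Compl_eq_Diff_UNIV card_Diff_subset of_nat_diff)
  then have "B \<noteq> {}" using n4 by auto
  then obtain c where c: "c \<in> B" by blast
  define J where "J = averaging (UNIV :: 'n set)"
  define P where "P = restriction B - averaging B"
  define C where "C = mat 1 - J"
  define Q where "Q = C - P"
  have Juv: "J $ u $ v = 1 / ?n" for u v by (simp add: J_def averaging_def)
  have Puv: "P $ u $ v = (if u \<in> B \<and> v \<in> B then (if u = v then 1 else 0) - 1 / (?n - 2) else 0)" for u v
    by (simp add: P_def restriction_def averaging_def cB[symmetric] indicator_def)
  have Quv: "Q $ u $ v = (if u = v then 1 else 0) - 1 / ?n - P $ u $ v" for u v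
    by (simp add: Q_def C_def Juv mat_def)
  have J: "sym_idem J" unfolding J_def by (rule sym_idem_averaging) simp
  have P: "sym_idem P"
    unfolding P_def using sym_idem_averaging[OF \<open>B \<noteq> {}\<close>] sym_idem_restriction restriction_averaging
    by (rule sym_idem_diff)
  have one': "sym_idem (mat 1 :: real^'n^'n)" by (simp add: sym_idem_def)
  have C: "sym_idem C" "C ** J = 0" "J ** C = 0"
    unfolding C_def using sym_idem_diff[OF J one'] by simp_all
  have colP: "(\<Sum>w\<in>UNIV. P $ w $ v) = 0" for v
  proof -
    have "(\<Sum>w\<in>UNIV. P $ w $ v) = (\<Sum>w\<in>B. P $ w $ v)"
      by (intro sum.mono_neutral_right) (auto simp: Puv)
    also have "\<dots> = (if v \<in> B then (\<Sum>w\<in>B. (if w = v then 1 else 0) - 1 / (?n - 2)) else 0)"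
      by (simp add: Puv)
    also have "\<dots> = 0" using n4 by (simp add: sum_subtractf cB)
    finally show ?thesis .
  qed
  have JP: "J ** P = 0"
    by (simp add: vec_eq_iff matrix_matrix_mult_def Juv sum_divide_distrib[symmetric] colP)
  have "P ** J = transpose (J ** P)" using J P by (simp add: matrix_transpose_mul sym_idem_def)
  then have PJ: "P ** J = 0" by (simp add: JP transpose_def vec_eq_iff)
  have CP: "C ** P = P" by (simp add: C_def matrix_mult_diff_left JP)
  have Q: "sym_idem Q" "Q ** P = 0" "P ** Q = 0"
    unfolding Q_def by (rule sym_idem_diff[OF P C(1) CP])+
  have QJ: "Q ** J = 0" by (simp add: Q_def matrix_mult_diff_left C(2) PJ)
  define N where "N = 2 *\<^sub>R P + ?n *\<^sub>R Q"
  have Nmult: "N ** A = 2 *\<^sub>R (P ** A) + ?n *\<^sub>R (Q ** A)" for A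
    by (simp add: N_def matrix_eq matrix_vector_mul_assoc[symmetric] matrix_vector_mult_add_rdistrib
        scaleR_matrix_vector_assoc[symmetric])
  have J1: "J *v 1 = 1" by (simp add: vec_eq_iff matrix_vector_mult_def Juv)
  have "N *v 1 = (N ** J) *v 1" by (simp add: matrix_vector_mul_assoc[symmetric] J1)
  also have "\<dots> = 0" by (simp add: Nmult PJ QJ)
  finally have N1: "N *v 1 = 0" .
  have "M = N"
  proof (rule matrix_eqI_row_sums)
    show "M *v 1 = N *v 1" by (simp add: one N1)
    fix u v :: 'n assume uv: "u \<noteq> v"
    have "N $ u $ v = 2 * P $ u $ v + ?n * (- 1 / ?n - P $ u $ v)"
      using uv by (simp add: N_def Quv)
    also have "\<dots> = - 1 - (?n - 2) * P $ u $ v" using n4 by (simp add: field_simps)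
    also have "\<dots> = (if u \<in> B \<and> v \<in> B then 0 else -1)" using uv n4 by (simp add: Puv)
    finally show "M $ u $ v = N $ u $ v"
      using entries uv by (auto simp: B_def)
  qed
  define R where "R l = (if l = 0 then J else if l = 2 then P else Q)" for l :: real
  have R: "R 0 = J" "R 2 = P" "R ?n = Q" using n4 by (auto simp: R_def)
  have nonzero: "J \<noteq> 0" "P \<noteq> 0" "Q \<noteq> 0"
  proof -
    have "J $ c $ c \<noteq> 0" "P $ c $ c \<noteq> 0" "Q $ a $ a \<noteq> 0"
      using c n4 by (simp_all add: Juv Puv Quv B_def)
    then show "J \<noteq> 0" "P \<noteq> 0" "Q \<noteq> 0" by auto
  qed
  have S: "eigenvalues M = {0, 2, ?n}" and pr: "\<And>l. l \<in> {0, 2, ?n} \<Longrightarrow> proj l = R l"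
  proof -
    have "(\<Sum>l\<in>{0, 2, ?n}. R l) = mat 1" using n4 by (simp add: R Q_def C_def)
    moreover have "sym_idem (R l)" "R l \<noteq> 0" "M ** R l = l *\<^sub>R R l" if "l \<in> {0, 2, ?n}" for l
      using that J P Q nonzero \<open>M = N\<close>
      by (auto simp: R Nmult PJ QJ sym_idem_def)
    ultimately show "eigenvalues M = {0, 2, ?n}" "\<And>l. l \<in> {0, 2, ?n} \<Longrightarrow> proj l = R l"
      using spectrum_eqI[of "{0, 2, ?n}" R] by blast+
  qed
  have pr': "proj 0 = J" "proj 2 = P" "proj ?n = Q" using pr R by auto
  show kc: "kernel_constant M" by unfold_locales (simp add: pr' Juv)
  interpret kernel_constant M by (rule kc)
  have AB: "{2} \<union> {?n} = spec" "{2} \<inter> {?n} = {}" using S n4 by auto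
  interpret sp: simplex_splitting "grp {2}" "grp {?n}" by (rule splitting[OF AB])
  have "deficit = 2 * sp.cost"
    using deficit_split[OF AB] by (simp add: grp_singleton)
  \<comment> \<open>The diagonal of \<open>P\<close> vanishes at a and b, so only the n - 2 vertices
    of \<open>B\<close> contribute, all equally.\<close>
  also have "sp.cost = (\<Sum>u\<in>B. (1 - 1 / (?n - 2)) * (1 / (?n - 2) - 1 / ?n))"
    unfolding sp.cost_def
    unfolding grp_singleton pr'
    by (subst sum.mono_neutral_right[of UNIV B]) (auto simp: Puv Quv)
  also have "\<dots> = (?n - 2) * ((1 - 1 / (?n - 2)) * (1 / (?n - 2) - 1 / ?n))"
    by (simp add: cB)
  also have "2 * \<dots> = extremal_deficit ?n"
  proof -
    have d: "?n \<noteq> 0" "?n - 2 \<noteq> 0" using n4 by auto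
    have "1 - 1 / (?n - 2) = (?n - 3) / (?n - 2)" "1 / (?n - 2) - 1 / ?n = 2 / (?n * (?n - 2))"
      using d by (simp_all add: diff_divide_eq_iff divide_diff_eq_iff diff_frac_eq)
    then show ?thesis using d by (simp add: extremal_deficit_def)
  qed
  finally show "deficit = extremal_deficit ?n" .
qed

section \<open>Graphs\<close>

lemma laziness_eq_deficit:
  fixes G :: "('a::finite, 'b) pre_digraph"
  assumes "kernel_constant (laplacian G)"
  shows "laziness G = 1 / real CARD('a) + real CARD('a) * (1 - 1 / real CARD('a))\<^sup>2
    - kernel_constant.deficit (laplacian G)"
proof -
  interpret kernel_constant "laplacian G" by (rule assms)
  have "laziness G = (\<Sum>u\<in>UNIV. (proj 0 $ u $ u)\<^sup>2) + (\<Sum>l\<in>spec. \<Sum>u\<in>UNIV. (proj l $ u $ u)\<^sup>2)"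
    unfolding laziness_eq by (rule sum.remove[OF finite_spectrum zero_in_eigenvalues])
  also have "(\<Sum>u\<in>UNIV. (proj 0 $ u $ u)\<^sup>2) = 1 / real CARD('a)"
    by (simp add: proj_0 power2_eq_square)
  also have "(\<Sum>l\<in>spec. \<Sum>u\<in>UNIV. (proj l $ u $ u)\<^sup>2)
      = real CARD('a) * (1 - 1 / real CARD('a))\<^sup>2 - deficit"
    unfolding deficit_def by (subst sum.swap) (simp add: sum_subtractf)
  finally show ?thesis by simp
qed

section \<open>The Laplacian of a connected graph\<close>

locale spanning_pair_graph = pair_graph X for X :: "'a::finite pair_pre_digraph" +
  assumes UNIV: "pverts X = UNIV"
begin

abbreviation L :: "real^'a^'a" where "L \<equiv> laplacian (with_proj X)"

lemma arc_commute: "(u, v) \<in> parcs X \<longleftrightarrow> (v, u) \<in> parcs X"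
  using arcs_symmetric by blast

lemma no_loop: "(u, u) \<notin> parcs X"
  using no_loops'[of u u] by auto

lemma graph_X: "graph (with_proj X)"
  by unfold_locales

lemma L_off_diagonal: "u \<noteq> v \<Longrightarrow> L $ u $ v = (if (u, v) \<in> parcs X then -1 else 0)"
  by (simp add: laplacian_def degree_matrix_def adjacency_matrix_def)

text \<open>Writing the product with differences along edges makes constants visibly lie in the
  kernel and prepares the maximum principle.\<close>

lemma L_mult_vec: "(L *v y) $ u = (\<Sum>v\<in>{v. (u, v) \<in> parcs X}. y $ u - y $ v)"
proof -
  have deg: "out_degree (with_proj X) u = card {v. (u, v) \<in> parcs X}" for u
  proof -
    have "out_arcs (with_proj X) u = Pair u ` {v. (u, v) \<in> parcs X}"
      by (auto simp: out_arcs_def)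
    then show ?thesis by (simp add: out_degree_def card_image inj_on_def)
  qed
  have "(L *v y) $ u = (\<Sum>v\<in>UNIV. (if u = v then real (card {v. (u, v) \<in> parcs X}) * y $ v else 0)
      - (if (u, v) \<in> parcs X then y $ v else 0))"
    unfolding matrix_vector_mult_def laplacian_def degree_matrix_def adjacency_matrix_def vec_lambda_beta
    by (intro sum.cong) (auto simp: deg left_diff_distrib)
  also have "\<dots> = real (card {v. (u, v) \<in> parcs X}) * y $ u - (\<Sum>v\<in>{v. (u, v) \<in> parcs X}. y $ v)"
    by (simp add: sum_subtractf sum.If_cases)
  finally show ?thesis by (simp add: sum_subtractf)
qed

lemma L_one: "L *v 1 = 0"
  by (simp add: vec_eq_iff L_mult_vec)

text \<open>Maximum principle: at a vertex where a kernel vector is maximal, all differences to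
  neighbours are nonnegative and sum to 0. So the maximum spreads along paths and, by connectedness,
  the vector is constant. The projection onto the constants is J/n.\<close>

lemma kernel_constant_L:
  assumes conn: "Digraph_Component.connected (with_proj X)"
  shows "kernel_constant L"
proof -
  have reach: "(u, v) \<in> (parcs X)\<^sup>*" for u v
  proof -
    have "u \<rightarrow>\<^sup>*\<^bsub>mk_symmetric (with_proj X)\<^esub> v"
      using conn by (simp add: Digraph_Component.connected_def strongly_connected_def UNIV)
    then have "u \<rightarrow>\<^sup>*\<^bsub>with_proj X\<^esub> v"
      using reachable_mk_symmetric_eq sym_arcs by blast
    then show ?thesis
      using rtrancl_on_rtranclI[of u v "pverts X" "parcs X"] by (simp add: reachable_def)
  qed
  have const: "y $ u = y $ v" if "L *v y = 0" for y u v
  proof -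
    obtain w where w: "\<And>v. y $ v \<le> y $ w"
    proof -
      have "Max (range (($) y)) \<in> range (($) y)" by (intro Max_in) auto
      then obtain w where "Max (range (($) y)) = y $ w" by (rule rangeE)
      then have "y $ v \<le> y $ w" for v by (metis Max_ge finite_imageI finite rangeI)
      then show ?thesis using that by blast
    qed
    have step: "y $ v = y $ w" if "(u, v) \<in> parcs X" "y $ u = y $ w" for u v
    proof -
      have "(\<Sum>v\<in>{v. (u, v) \<in> parcs X}. y $ u - y $ v) = 0"
        using \<open>L *v y = 0\<close> L_mult_vec[of y u] by simp
      then have "\<forall>v\<in>{v. (u, v) \<in> parcs X}. y $ u - y $ v = 0"
        using w that(2) by (subst (asm) sum_nonneg_eq_0_iff) auto
      then show ?thesis using that by auto
    qed
    have all: "y $ v = y $ w" for v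
      using reach[of w v] by (induction rule: rtrancl_induct) (auto intro: step)
    show ?thesis using all[of u] all[of v] by simp
  qed
  interpret symmetric_matrix L
    by unfold_locales (rule transpose_laplacian[OF graph_X])
  define J :: "real^'a^'a" where "J = (\<chi> u v. 1 / real CARD('a))"
  have Jv: "J *v x = ((\<Sum>v\<in>UNIV. x $ v) / real CARD('a)) *\<^sub>R 1" for x
    by (simp add: J_def vec_eq_iff matrix_vector_mult_def sum_divide_distrib)
  have "is_orth_proj (eigenspace L 0) J"
    unfolding is_orth_proj_def
  proof (intro allI conjI ballI)
    fix x y
    show "J *v x \<in> eigenspace L 0"
      by (simp add: Jv eigenspace_def matrix_vector_mult_scaleR L_one)
    assume "y \<in> eigenspace L 0"
    then have "L *v y = 0" by (simp add: eigenspace_def)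
    define k where "k = y $ undefined"
    have c: "y $ u = k" for u unfolding k_def by (rule const[OF \<open>L *v y = 0\<close>])
    have "(x - J *v x) \<bullet> y = (\<Sum>u\<in>UNIV. (x $ u - (\<Sum>v\<in>UNIV. x $ v) / real CARD('a)) * k)"
      unfolding inner_vec_def by (intro sum.cong refl) (simp add: Jv c)
    also have "\<dots> = 0"
      by (simp add: sum_distrib_right[symmetric] sum_subtractf)
    finally show "orthogonal (x - J *v x) y" by (simp add: orthogonal_def)
  qed
  then have "proj 0 = J"
    using is_orth_proj_unique[OF subspace_eigenspace] is_orth_proj_orth_proj[OF subspace_eigenspace]
    by blast
  then show ?thesis by unfold_locales (simp add: J_def)
qed

lemma ex_arc:
  assumes "kernel_constant L" "CARD('a) \<ge> 2"
  shows "\<exists>v. (u, v) \<in> parcs X"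
proof -
  obtain v where "v \<noteq> u" "L $ u $ v \<noteq> 0"
    using kernel_constant.nonzero_in_row[OF assms] by blast
  then show ?thesis using L_off_diagonal[of u v] by (auto split: if_splits)
qed

text \<open>This describes the extremal graph by its two universal vertices instead of a part
  function, a form that Laplacian entries and isomorphisms both handle directly.\<close>

definition dominating_pair :: "'a \<Rightarrow> 'a \<Rightarrow> bool" where
  "dominating_pair a b \<longleftrightarrow> a \<noteq> b \<and> parcs X = {(u, v). u \<noteq> v \<and> (u \<in> {a, b} \<or> v \<in> {a, b})}"

lemma dominating_pair_iff:
  "dominating_pair a b \<longleftrightarrow> a \<noteq> b \<and>
    (\<forall>u v. u \<noteq> v \<longrightarrow> L $ u $ v = (if u \<in> {a, b} \<or> v \<in> {a, b} then -1 else 0))"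
proof -
  have "parcs X = {(u, v). u \<noteq> v \<and> (u \<in> {a, b} \<or> v \<in> {a, b})} \<longleftrightarrow>
      (\<forall>u v. u \<noteq> v \<longrightarrow> ((u, v) \<in> parcs X \<longleftrightarrow> u \<in> {a, b} \<or> v \<in> {a, b}))"
    unfolding set_eq_iff split_paired_All by (intro iff_allI) (use no_loop in auto)
  also have "\<dots> \<longleftrightarrow> (\<forall>u v. u \<noteq> v \<longrightarrow> L $ u $ v = (if u \<in> {a, b} \<or> v \<in> {a, b} then -1 else 0))"
    by (intro iff_allI imp_cong refl) (simp add: L_off_diagonal)
  finally show ?thesis unfolding dominating_pair_def by (rule arg_cong)
qed

lemma laziness_dominating_pair:
  assumes "CARD('a) \<ge> 4" "dominating_pair a b"
  shows "laziness (with_proj X) = 1 / real CARD('a) + real CARD('a) * (1 - 1 / real CARD('a))\<^sup>2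
    - extremal_deficit (real CARD('a))"
proof -
  note ex = extremal_spectrum[OF assms(1) transpose_laplacian[OF graph_X] L_one]
  have "a \<noteq> b" "\<forall>u v. u \<noteq> v \<longrightarrow> L $ u $ v = (if u \<in> {a, b} \<or> v \<in> {a, b} then -1 else 0)"
    using assms(2) unfolding dominating_pair_iff by blast+
  then show ?thesis using laziness_eq_deficit[OF ex(1)] ex(2) by simp
qed

end


lemma complete_multipartite_dominating_pair:
  fixes Y :: "'b::finite pair_pre_digraph"
  assumes Y: "pverts Y = UNIV" "complete_multipartite_digraph [n - 2, 1, 1] (with_proj Y)" and n: "n \<ge> 2"
  shows "spanning_pair_graph Y" "CARD('b) = n" "\<exists>a b. spanning_pair_graph.dominating_pair Y a b"
proof -
  obtain part where lt': "\<forall>v\<in>UNIV. part v < length [n - 2, 1, 1]"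
    and card': "\<forall>i<length [n - 2, 1, 1]. card {v \<in> UNIV. part v = i} = [n - 2, 1, 1] ! i"
    and arcs': "parcs Y = {(u, v). u \<in> UNIV \<and> v \<in> UNIV \<and> part u \<noteq> part v}"
    using Y(2) unfolding complete_multipartite_digraph_def with_proj_simps Y(1) by blast
  have lt: "part v < 3" for v using lt' by (simp add: numeral_3_eq_3)
  have card: "\<forall>i<3. card {v. part v = i} = [n - 2, 1, 1] ! i"
    using card' by (simp add: numeral_3_eq_3)
  have arcs: "parcs Y = {(u, v). part u \<noteq> part v}" using arcs' by simp
  have "pair_graph Y"
    by unfold_locales (auto simp: Y(1) arcs symmetric_def sym_def)
  then show sp: "spanning_pair_graph Y"
    using Y(1) by (simp add: spanning_pair_graph_def spanning_pair_graph_axioms_def)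
  have c: "card {v. part v = 0} = n - 2" "card {v. part v = 1} = 1" "card {v. part v = 2} = 1"
    using card[rule_format, of 0] card[rule_format, of 1] card[rule_format, of 2] by simp_all
  obtain a where a: "{v. part v = 1} = {a}" using c(2) by (rule card_1_singletonE)
  obtain b where b: "{v. part v = 2} = {b}" using c(3) by (rule card_1_singletonE)
  have a': "part v = 1 \<longleftrightarrow> v = a" for v using a by blast
  have b': "part v = 2 \<longleftrightarrow> v = b" for v using b by blast
  have o': "part v = 0 \<longleftrightarrow> v \<noteq> a \<and> v \<noteq> b" for v
    using lt[of v] a'[of v] b'[of v] by linarith
  have ab: "a \<noteq> b" using a'[of a] b'[of a] by auto
  have "{v. part v = 0} = - {a, b}" using o' by auto
  then have "card (- {a, b}) = n - 2" using c(1) by simp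
  moreover have "card (- {a, b}) = CARD('b) - 2"
    using ab by (simp add: Compl_eq_Diff_UNIV card_Diff_subset)
  \<comment> \<open>Subtraction on naturals is truncated; 2 cancels because both
    \<open>CARD('b)\<close> and \<open>n\<close> are at least 2.\<close>
  moreover have "CARD('b) \<ge> 2"
    using card_mono[of UNIV "{a, b}"] ab by simp
  ultimately show "CARD('b) = n" using n by simp
  have "part u \<noteq> part v \<longleftrightarrow> u \<noteq> v \<and> (u \<in> {a, b} \<or> v \<in> {a, b})" for u v
    using a'[of u] b'[of u] o'[of u] a'[of v] b'[of v] o'[of v] by auto
  then have "spanning_pair_graph.dominating_pair Y a b"
    unfolding spanning_pair_graph.dominating_pair_def[OF sp] using ab arcs by auto
  then show "\<exists>a b. spanning_pair_graph.dominating_pair Y a b" by blast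
qed

section \<open>Isomorphism with the extremal graph\<close>

lemma digraph_isoI:
  assumes "wf_digraph (with_proj X)" "bij_betw f (pverts X) (pverts Y)"
    and "parcs Y = map_prod f f ` parcs X"
  shows "digraph_iso (with_proj X) (with_proj Y)"
proof -
  let ?h = "\<lparr>iso_verts = f, iso_arcs = map_prod f f, iso_head = snd, iso_tail = fst\<rparr>"
  have inj: "inj_on f (pverts X)" and im: "f ` pverts X = pverts Y"
    using assms(2) by (auto simp: bij_betw_def)
  have "parcs X \<subseteq> pverts X \<times> pverts X"
    using wf_digraph.head_in_verts[OF assms(1)] wf_digraph.tail_in_verts[OF assms(1)] by fastforce
  then have "inj_on (map_prod f f) (parcs X)"
    using map_prod_inj_on[OF inj inj] inj_on_subset by blast
  then have "pre_digraph.digraph_isomorphism (with_proj X) ?h"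
    unfolding pre_digraph.digraph_isomorphism_def using assms(1) inj by simp
  moreover have "with_proj Y = app_iso ?h (with_proj X)"
    unfolding app_iso_def with_proj_def using im assms(3) by simp
  ultimately show ?thesis unfolding digraph_iso_def by blast
qed

text \<open>Adjacency of distinct vertices depends only on membership in the pair, so any bijection
  that matches the two pairs is an isomorphism.\<close>

lemma dominating_pair_iso:
  fixes X :: "'a::finite pair_pre_digraph" and Y :: "'b::finite pair_pre_digraph"
  assumes X: "spanning_pair_graph X" and Y: "spanning_pair_graph Y" and card: "CARD('a) = CARD('b)"
    and a: "spanning_pair_graph.dominating_pair X a1 a2"
    and b: "spanning_pair_graph.dominating_pair Y b1 b2"
  shows "digraph_iso (with_proj X) (with_proj Y)"
proof -
  interpret X: spanning_pair_graph X by (rule X)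
  interpret Y: spanning_pair_graph Y by (rule Y)
  have a': "a1 \<noteq> a2" "parcs X = {(u, v). u \<noteq> v \<and> (u \<in> {a1, a2} \<or> v \<in> {a1, a2})}"
    using a unfolding X.dominating_pair_def by blast+
  have b': "b1 \<noteq> b2" "parcs Y = {(u, v). u \<noteq> v \<and> (u \<in> {b1, b2} \<or> v \<in> {b1, b2})}"
    using b unfolding Y.dominating_pair_def by blast+
  have "card (- {a1, a2}) = card (- {b1, b2})"
    using a'(1) b'(1) card by (simp add: Compl_eq_Diff_UNIV card_Diff_subset)
  then obtain g where g: "bij_betw g (- {a1, a2}) (- {b1, b2})"
    by (metis finite finite_same_card_bij)
  define f where "f u = (if u = a1 then b1 else if u = a2 then b2 else g u)" for u
  have b12: "bij_betw f {a1, a2} {b1, b2}"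
    using a'(1) b'(1) by (auto simp: bij_betw_def f_def)
  have "bij_betw f (- {a1, a2}) (- {b1, b2})"
    using g by (rule bij_betw_cong[THEN iffD1, rotated]) (auto simp: f_def)
  with b12 have "bij_betw f ({a1, a2} \<union> - {a1, a2}) ({b1, b2} \<union> - {b1, b2})"
    by (rule bij_betw_combine) simp
  then have bij: "bij f" by (simp only: Compl_partition)
  have im: "f ` {a1, a2} = {b1, b2}" using b12 by (simp only: bij_betw_def)
  have fin: "f u \<in> {b1, b2} \<longleftrightarrow> u \<in> {a1, a2}" for u
    using bij im by (metis bij_is_inj inj_image_mem_iff)
  show ?thesis
  proof (rule digraph_isoI)
    show "wf_digraph (with_proj X)" by unfold_locales
    show "bij_betw f (pverts X) (pverts Y)" using bij by (simp add: X.UNIV Y.UNIV)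
    show "parcs Y = map_prod f f ` parcs X"
    proof (intro set_eqI iffI)
      fix e assume e: "e \<in> parcs Y"
      obtain u v where uv: "e = (f u, f v)"
        using bij by (metis bij_pointE surj_pair)
      have "(u, v) \<in> parcs X" using e fin unfolding uv a'(2) b'(2) by auto
      then show "e \<in> map_prod f f ` parcs X" unfolding uv by force
    next
      fix e assume "e \<in> map_prod f f ` parcs X"
      then obtain u v where uv: "e = (f u, f v)" "(u, v) \<in> parcs X" by auto
      have "f u = f v \<longleftrightarrow> u = v" using bij by (simp add: bij_is_inj inj_eq)
      then show "e \<in> parcs Y" using uv(2) fin unfolding uv(1) a'(2) b'(2) by auto
    qed
  qed
qed

lemma digraph_iso_dominating_pair:
  fixes X :: "'a::finite pair_pre_digraph" and Y :: "'b::finite pair_pre_digraph"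
  assumes X: "spanning_pair_graph X" and Y: "spanning_pair_graph Y"
    and b: "spanning_pair_graph.dominating_pair Y b1 b2"
    and iso: "digraph_iso (with_proj X) (with_proj Y)"
  shows "\<exists>a1 a2. spanning_pair_graph.dominating_pair X a1 a2"
proof -
  interpret X: spanning_pair_graph X by (rule X)
  interpret Y: spanning_pair_graph Y by (rule Y)
  obtain h where h: "X.digraph_isomorphism h" "with_proj Y = app_iso h (with_proj X)"
    using iso unfolding digraph_iso_def by blast
  define f where "f = iso_verts h"
  have inj: "inj f" using h(1) by (simp add: X.digraph_isomorphism_def f_def X.UNIV)
  have surj: "range f = UNIV"
    using arg_cong[OF h(2), of verts] by (simp add: verts_app_iso f_def X.UNIV Y.UNIV)
  have parcs: "parcs Y = (\<lambda>(u, v). (f u, f v)) ` parcs X"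
    using arg_cong[OF h(2), of arcs_ends] X.arcs_ends_app_iso_eq[OF h(1)] by (simp add: f_def)
  have arc: "(f u, f v) \<in> parcs Y \<longleftrightarrow> (u, v) \<in> parcs X" for u v
    unfolding parcs using inj by (auto simp: inj_eq)
  obtain a1 a2 where a: "f a1 = b1" "f a2 = b2" using surj by (metis surjD)
  have b': "b1 \<noteq> b2" "parcs Y = {(u, v). u \<noteq> v \<and> (u \<in> {b1, b2} \<or> v \<in> {b1, b2})}"
    using b unfolding Y.dominating_pair_def by blast+
  have "(u, v) \<in> parcs X \<longleftrightarrow> u \<noteq> v \<and> (u \<in> {a1, a2} \<or> v \<in> {a1, a2})" for u v
    unfolding arc[symmetric] b'(2) a[symmetric] using inj by (auto simp: inj_eq)
  then have "X.dominating_pair a1 a2"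
    unfolding X.dominating_pair_def using a b'(1) by auto
  then show ?thesis by blast
qed

section \<open>Stars and graphs with at most three vertices\<close>

context spanning_pair_graph
begin

lemma star_digraphI:
  assumes "parcs X = {c} \<times> (- {c}) \<union> (- {c}) \<times> {c}"
  shows "star_digraph CARD('a) (with_proj X)"
proof -
  have "card (- {c}) = CARD('a) - 1" by (simp add: Compl_eq_Diff_UNIV card_Diff_subset)
  then have "complete_bipartite_digraph 1 (CARD('a) - 1) (with_proj X)"
    unfolding complete_bipartite_digraph_def
    by (intro conjI graph_X) (rule exI[of _ "{c}"], rule exI[of _ "- {c}"], simp add: UNIV assms)
  then show ?thesis by (simp add: star_digraph_def Suc_le_eq)
qed

text \<open>Two nonadjacent vertices a and b each need a neighbour. A neighbour c of a completes the
  list of at most three vertices, so c is also the neighbour of b and the graph is a star with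
  centre c.\<close>

lemma small_graph_complete_or_star:
  assumes small: "CARD('a) \<le> 3" and deg: "CARD('a) \<ge> 2 \<Longrightarrow> \<forall>u. \<exists>v. (u, v) \<in> parcs X"
  shows "complete_digraph CARD('a) (with_proj X) \<or> star_digraph CARD('a) (with_proj X)"
proof (cases "\<forall>u v. u \<noteq> v \<longrightarrow> (u, v) \<in> parcs X")
  case True
  then have "parcs X = {(u, v). u \<noteq> v}" using no_loop by auto
  then show ?thesis using graph_X by (simp add: complete_digraph_def UNIV)
next
  case False
  then obtain a b where ab: "a \<noteq> b" "(a, b) \<notin> parcs X" by blast
  have "card {a, b} \<le> CARD('a)" by (intro card_mono) auto
  then have two: "CARD('a) \<ge> 2" using ab(1) by simp
  obtain c where c: "(a, c) \<in> parcs X" using deg[OF two] by blast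
  have cab: "c \<noteq> a" "c \<noteq> b" using c ab(2) no_loop by auto
  then have card: "card {a, b, c} = 3" using ab(1) by auto
  then have U: "UNIV = {a, b, c}"
    using small by (metis card_mono card_subset_eq finite le_antisym subset_UNIV)
  obtain d where d: "(b, d) \<in> parcs X" using deg[OF two] by blast
  have "d \<in> {a, b, c}" using U by blast
  then have "d = c" using d ab(2) no_loop arc_commute[of b a] by auto
  then have bc: "(b, c) \<in> parcs X" using d by simp
  have arcs: "(u, v) \<in> parcs X \<longleftrightarrow> (u, v) \<in> {c} \<times> {a, b} \<union> {a, b} \<times> {c}" for u v
  proof -
    have "u \<in> {a, b, c}" "v \<in> {a, b, c}" using U by blast+
    then show ?thesis
      using c bc ab(2) no_loop arc_commute[of a b] arc_commute[of a c] arc_commute[of b c] cab by auto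
  qed
  have "parcs X = {c} \<times> {a, b} \<union> {a, b} \<times> {c}"
    by (rule set_eqI) (simp only: split_paired_all arcs)
  moreover have "{a, b} = - {c}" using U cab by auto
  ultimately have "star_digraph CARD('a) (with_proj X)" by (intro star_digraphI[of c]) simp
  then show ?thesis by blast
qed

lemma star_digraphI_laplacian:
  assumes "\<forall>u v. u \<noteq> v \<longrightarrow> L $ u $ v = (if u = c \<or> v = c then -1 else 0)"
  shows "star_digraph CARD('a) (with_proj X)"
proof (rule star_digraphI)
  have "(u, v) \<in> parcs X \<longleftrightarrow> (u, v) \<in> {c} \<times> (- {c}) \<union> (- {c}) \<times> {c}" for u v
    using assms[rule_format, of u v] L_off_diagonal[of u v] no_loop[of u]
    by (cases "u = v") (auto split: if_splits)
  then show "parcs X = {c} \<times> (- {c}) \<union> (- {c}) \<times> {c}" by auto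
qed

end

theorem theorem7p7:
  fixes X :: "'a::finite pair_pre_digraph"
    and Y :: "'b::finite pair_pre_digraph"
    and n :: nat
  assumes "pair_graph X"
    and "pverts X = UNIV"
    and "n = card (pverts X)"
    and "Digraph_Component.connected (with_proj X)"
    and "\<not> complete_digraph n (with_proj X)"
    and "\<not> star_digraph n (with_proj X)"
    and "pverts Y = UNIV"
    and "complete_multipartite_digraph [n - 2, 1, 1] (with_proj Y)"
  shows "laziness (with_proj X) \<le> laziness (with_proj Y) \<and>
         (laziness (with_proj X) = laziness (with_proj Y) \<longleftrightarrow> digraph_iso (with_proj X) (with_proj Y))"
proof -
  have X: "spanning_pair_graph X"
    using assms(1,2) by (simp add: spanning_pair_graph_def spanning_pair_graph_axioms_def)
  interpret X: spanning_pair_graph X by (rule X)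
  have n: "CARD('a) = n" using assms(2,3) by simp
  have kc: "kernel_constant X.L" by (rule X.kernel_constant_L[OF assms(4)])
  interpret kernel_constant X.L by (rule kc)
  \<comment> \<open>Connectedness rules out isolated vertices, so with fewer than four vertices the
    graph would be complete or a star.\<close>
  have n4: "CARD('a) \<ge> 4"
  proof (rule ccontr)
    assume "\<not> ?thesis"
    then show False
      using X.small_graph_complete_or_star X.ex_arc[OF kc] assms(5,6) n by auto
  qed
  then have "n \<ge> 2" using n by simp
  note Y = complete_multipartite_dominating_pair[OF assms(7,8) this]
  obtain b1 b2 where b: "spanning_pair_graph.dominating_pair Y b1 b2" using Y(3) by blast
  have Ylaz: "laziness (with_proj Y) = 1 / real CARD('a) + real CARD('a) * (1 - 1 / real CARD('a))\<^sup>2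
      - extremal_deficit (real CARD('a))"
    using spanning_pair_graph.laziness_dominating_pair[OF Y(1) _ b] Y(2) n n4 by simp
  note Xlaz = laziness_eq_deficit[OF kc]
  have entries: "\<forall>u v. u \<noteq> v \<longrightarrow> X.L $ u $ v = 0 \<or> X.L $ u $ v = -1"
    by (simp add: X.L_off_diagonal)
  have not_complete: "\<exists>u v. u \<noteq> v \<and> X.L $ u $ v = 0"
  proof (rule ccontr)
    assume "\<not> ?thesis"
    then have "parcs X = {(u, v). u \<noteq> v}"
      using X.no_loop X.L_off_diagonal by fastforce
    then show False
      using assms(5) X.graph_X n by (simp add: complete_digraph_def X.UNIV)
  qed
  have not_star: "\<nexists>c. \<forall>u v. u \<noteq> v \<longrightarrow> X.L $ u $ v = (if u = c \<or> v = c then -1 else 0)"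
  proof (rule notI, erule exE)
    fix c assume c: "\<forall>u v. u \<noteq> v \<longrightarrow> X.L $ u $ v = (if u = c \<or> v = c then -1 else 0)"
    show False using X.star_digraphI_laplacian[OF c] assms(6) n by simp
  qed
  \<comment> \<open>Both values of laziness are the same constant minus a deficit, so lower bounds
    for the deficit become upper bounds for laziness.\<close>
  note bound = deficit_bound[OF n4 entries not_complete not_star]
  have le: "laziness (with_proj X) \<le> laziness (with_proj Y)"
    using bound(1) Xlaz Ylaz by simp
  moreover have "digraph_iso (with_proj X) (with_proj Y)"
    if "laziness (with_proj X) = laziness (with_proj Y)"
  proof -
    have "deficit = extremal_deficit (real CARD('a))" using that Xlaz Ylaz by simp
    then obtain a1 a2 where "X.dominating_pair a1 a2"
      using bound(2) unfolding X.dominating_pair_iff by blast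
    then show ?thesis using dominating_pair_iso[OF X Y(1) _ _ b] Y(2) n by simp
  qed
  moreover have "laziness (with_proj X) = laziness (with_proj Y)"
    if iso: "digraph_iso (with_proj X) (with_proj Y)"
  proof -
    obtain a1 a2 where "X.dominating_pair a1 a2"
      using digraph_iso_dominating_pair[OF X Y(1) b iso] by blast
    then show ?thesis using X.laziness_dominating_pair[OF n4] Ylaz by simp
  qed
  ultimately show ?thesis by blast
qed

end
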